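(* Let $m,n,t\in\mathbb Z_{\le-1}$ be not all equal to $-1$. Then $Q^{\pm}(m,n,t)$ does not have finite growth.
   Context: $Q^{\pm}(m,n,t)$ is the contragredient Lie superalgebra $\mathfrak g(A)$ with $$A=\begin{pmatrix} 0&1&a \\ b&0&1 \\ 1&c&0 \end{pmatrix},\qquad p(1)=p(2)=p(3)=1,$$ where $a,b,c$ are nonzero numbers with $1+a+\frac1b=m$, $1+b+\frac1c=n$, $1+c+\frac1a=t$ (there are two solutions: $Q^-$ has $a,b,c<-1$ and $Q^+$ has $-1<a,b,c<0$). Here, for an $N\times N$ matrix $A=(a_{ij})$ with parity function $p$: $\mathfrak h$ has dimension $2N-\operatorname{rk}A$ with linearly independent $\alpha_i\in\mathfrak h^*$ and linearly independent $h_i\in\mathfrak h$, $\alpha_j(h_i)=a_{ij}$; $\mathfrak g(A)$ is generated by $\mathfrak h$ (even) and $X_i,Y_i$ of parity $p(i)$ with relations $[h,h']=0$, $[h,X_i]=\alpha_i(h)X_i$, $[h,Y_i]=-\alpha_i(h)Y_i$, $[X_i,Y_j]=\delta_{ij}h_i$, modulo the unique maximal ideal intersecting $\mathfrak h$ trivially. $\mathfrak g(A)$ has finite growth if, for the $\mathbb Z$-grading with $\mathfrak g_0=\mathfrak h$, $\deg X_i=1$, $\deg Y_i=-1$, $\dim\mathfrak g_r$ grows polynomially in $r$. *)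

theory Defs
  imports
    "HOL-Analysis.Analysis"
    "HOL-Library.Poly_Mapping"
    "HOL-Library.Extended_Nat"
    "HOL-Library.Z2"
    "HOL-Computational_Algebra.Polynomial"
begin

section \<open>Realizations of a matrix\<close>

text \<open>
  The whole type \<open>'h\<close>, with scalar multiplication \<open>sc\<close>, is the Cartan space. The last clause
  is linear independence of the family \<open>\<alpha>\<close> in the dual space.
\<close>

definition realization ::
  "('k::field \<Rightarrow> 'h::ab_group_add \<Rightarrow> 'h) \<Rightarrow> 'k^'n^'n \<Rightarrow> ('n \<Rightarrow> 'h) \<Rightarrow> ('n \<Rightarrow> 'h \<Rightarrow> 'k) \<Rightarrow> bool"
  where
  "realization sc A hv \<alpha> \<longleftrightarrow>
     vector_space sc \<and>
     (\<exists>B. finite B \<and> \<not> module.dependent sc B \<and> module.span sc B = UNIV \<and>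
          card B = 2 * CARD('n) - rank A) \<and>
     (\<forall>i. Vector_Spaces.linear sc (*) (\<alpha> i)) \<and>
     (\<forall>i j. \<alpha> j (hv i) = A $ i $ j) \<and>
     (\<forall>u. (\<Sum>i\<in>UNIV. sc (u i) (hv i)) = 0 \<longrightarrow> (\<forall>i. u i = 0)) \<and>
     (\<forall>u. (\<forall>x. (\<Sum>i\<in>UNIV. u i * \<alpha> i x) = 0) \<longrightarrow> (\<forall>i. u i = 0))"


section \<open>The free nonassociative superalgebra\<close>

datatype ('h, 'n) generator = Cartan 'h | X 'n | Y 'n

datatype 'g monomial = Gen 'g | Prod "'g monomial" "'g monomial"

type_synonym ('h, 'n, 'k) free_alg = "('h, 'n) generator monomial \<Rightarrow>\<^sub>0 'k"

definition fscale :: "'k::field \<Rightarrow> ('b \<Rightarrow>\<^sub>0 'k) \<Rightarrow> ('b \<Rightarrow>\<^sub>0 'k)" where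
  "fscale c f = Poly_Mapping.map ((*) c) f"

lemma lookup_fscale [simp]: "Poly_Mapping.lookup (fscale c f) t = c * Poly_Mapping.lookup f t"
  unfolding fscale_def by transfer (simp add: when_def)

interpretation free: vector_space "fscale :: 'k::field \<Rightarrow> ('b \<Rightarrow>\<^sub>0 'k) \<Rightarrow> ('b \<Rightarrow>\<^sub>0 'k)"
  by unfold_locales (auto intro!: poly_mapping_eqI simp: lookup_add algebra_simps)

definition gen :: "'g \<Rightarrow> 'g monomial \<Rightarrow>\<^sub>0 'k::field" where
  "gen g = Poly_Mapping.single (Gen g) 1"

definition br ::
  "('g monomial \<Rightarrow>\<^sub>0 'k::field) \<Rightarrow> ('g monomial \<Rightarrow>\<^sub>0 'k) \<Rightarrow> ('g monomial \<Rightarrow>\<^sub>0 'k)" where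
  "br f g = (\<Sum>s\<in>Poly_Mapping.keys f. \<Sum>t\<in>Poly_Mapping.keys g.
     Poly_Mapping.single (Prod s t) (Poly_Mapping.lookup f s * Poly_Mapping.lookup g t))"

primrec gen_parity :: "('n \<Rightarrow> bit) \<Rightarrow> ('h, 'n) generator \<Rightarrow> bit" where
  "gen_parity p (Cartan x) = 0"
| "gen_parity p (X i) = p i"
| "gen_parity p (Y i) = p i"

primrec monomial_parity :: "('n \<Rightarrow> bit) \<Rightarrow> ('h, 'n) generator monomial \<Rightarrow> bit" where
  "monomial_parity p (Gen g) = gen_parity p g"
| "monomial_parity p (Prod s t) = monomial_parity p s + monomial_parity p t"

primrec gen_degree :: "('h, 'n) generator \<Rightarrow> int" where
  "gen_degree (Cartan x) = 0"
| "gen_degree (X i) = 1"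
| "gen_degree (Y i) = -1"

primrec monomial_degree :: "('h, 'n) generator monomial \<Rightarrow> int" where
  "monomial_degree (Gen g) = gen_degree g"
| "monomial_degree (Prod s t) = monomial_degree s + monomial_degree t"

definition parity_part :: "('n \<Rightarrow> bit) \<Rightarrow> bit \<Rightarrow> ('h, 'n, 'k::field) free_alg set" where
  "parity_part p \<epsilon> = {f. \<forall>t\<in>Poly_Mapping.keys f. monomial_parity p t = \<epsilon>}"

definition degree_part :: "int \<Rightarrow> ('h, 'n, 'k::field) free_alg set" where
  "degree_part r = {f. \<forall>t\<in>Poly_Mapping.keys f. monomial_degree t = r}"

definition super_sign :: "bit \<Rightarrow> bit \<Rightarrow> 'k::field" where
  "super_sign \<epsilon> \<delta> = (if \<epsilon> = 1 \<and> \<delta> = 1 then -1 else 1)"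

definition super_ideal :: "('n \<Rightarrow> bit) \<Rightarrow> ('h, 'n, 'k::field) free_alg set \<Rightarrow> bool" where
  "super_ideal p J \<longleftrightarrow>
     free.subspace J \<and>
     (\<forall>f\<in>J. \<forall>g. br f g \<in> J \<and> br g f \<in> J) \<and>
     (\<forall>f\<in>J. \<exists>f0\<in>J \<inter> parity_part p 0. \<exists>f1\<in>J \<inter> parity_part p 1. f = f0 + f1)"


section \<open>Contragredient Lie superalgebras\<close>

text \<open>
  A Lie superalgebra presented by generators and relations is the quotient of the free
  nonassociative superalgebra by the ideal generated by the Lie superalgebra axioms
  together with the relations. The first two sets below are the linear relations that make
  \<open>Cartan\<close> linear, so that \<open>\<hh>\<close> is included as a vector space, and the next two
  are super skew-symmetry and the super Jacobi identity.
\<close>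

definition relators ::
  "('k::field \<Rightarrow> 'h::ab_group_add \<Rightarrow> 'h) \<Rightarrow> ('n \<Rightarrow> 'h) \<Rightarrow> ('n \<Rightarrow> 'h \<Rightarrow> 'k) \<Rightarrow> ('n \<Rightarrow> bit)
     \<Rightarrow> ('h, 'n, 'k) free_alg set" where
  "relators sc hv \<alpha> p =
     {gen (Cartan (x + y)) - gen (Cartan x) - gen (Cartan y) | x y. True} \<union>
     {gen (Cartan (sc c x)) - fscale c (gen (Cartan x)) | c x. True} \<union>
     {br f g + fscale (super_sign \<epsilon> \<delta>) (br g f) | f g \<epsilon> \<delta>.
        f \<in> parity_part p \<epsilon> \<and> g \<in> parity_part p \<delta>} \<union>
     {br f (br g k) - br (br f g) k - fscale (super_sign \<epsilon> \<delta>) (br g (br f k)) | f g k \<epsilon> \<delta>.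
        f \<in> parity_part p \<epsilon> \<and> g \<in> parity_part p \<delta>} \<union>
     {br (gen (Cartan x)) (gen (Cartan y)) | x y. True} \<union>
     {br (gen (Cartan x)) (gen (X i)) - fscale (\<alpha> i x) (gen (X i)) | x i. True} \<union>
     {br (gen (Cartan x)) (gen (Y i)) + fscale (\<alpha> i x) (gen (Y i)) | x i. True} \<union>
     {br (gen (X i)) (gen (Y j)) - (if i = j then gen (Cartan (hv i)) else 0) | i j. True}"

definition relation_ideal ::
  "('k::field \<Rightarrow> 'h::ab_group_add \<Rightarrow> 'h) \<Rightarrow> ('n \<Rightarrow> 'h) \<Rightarrow> ('n \<Rightarrow> 'h \<Rightarrow> 'k) \<Rightarrow> ('n \<Rightarrow> bit)
     \<Rightarrow> ('h, 'n, 'k) free_alg set" where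
  "relation_ideal sc hv \<alpha> p = super_ideal p hull relators sc hv \<alpha> p"

text \<open>
  Ideals of the presented algebra (free algebra modulo \<open>relation_ideal\<close>) are represented by
  their preimages, i.e. by the ideals of the free algebra containing \<open>relation_ideal\<close>. The image
  of \<open>\<hh>\<close> consists of the classes of the generators \<open>Cartan x\<close>, so the last clause of the
  \<open>GREATEST\<close> below says that the ideal meets \<open>\<hh>\<close> trivially.
\<close>

definition contragredient_ideal ::
  "('k::field \<Rightarrow> 'h::ab_group_add \<Rightarrow> 'h) \<Rightarrow> ('n \<Rightarrow> 'h) \<Rightarrow> ('n \<Rightarrow> 'h \<Rightarrow> 'k) \<Rightarrow> ('n \<Rightarrow> bit)
     \<Rightarrow> ('h, 'n, 'k) free_alg set" where
  "contragredient_ideal sc hv \<alpha> p =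
     (GREATEST J. super_ideal p J \<and> relation_ideal sc hv \<alpha> p \<subseteq> J \<and>
        (\<forall>x. gen (Cartan x) \<in> J \<longrightarrow> gen (Cartan x) \<in> relation_ideal sc hv \<alpha> p))"

text \<open>
  The dimension of the image of the subspace \<open>V\<close> in the quotient by \<open>I\<close>, as the least number of
  vectors spanning it (\<open>\<infinity>\<close> if there is no finite spanning set).
\<close>

definition quotient_dim :: "('b \<Rightarrow>\<^sub>0 'k::field) set \<Rightarrow> ('b \<Rightarrow>\<^sub>0 'k) set \<Rightarrow> enat" where
  "quotient_dim I V = (INF B\<in>{B. finite B \<and> V \<subseteq> free.span (I \<union> B)}. enat (card B))"

lemma quotient_dim_eq_dim:
  fixes s2 :: "'k::field \<Rightarrow> 'w::ab_group_add \<Rightarrow> 'w" and V :: "('b \<Rightarrow>\<^sub>0 'k) set"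
  assumes lin: "Vector_Spaces.linear fscale s2 f"
    and ker: "{x. f x = 0} = I"
    and fin: "finite C" "f ` V \<subseteq> module.span s2 C"
  shows "quotient_dim I V = enat (vector_space.dim s2 (f ` V))"
proof -
  interpret L: Vector_Spaces.linear fscale s2 f by (rule lin)
  have le: "enat (L.vs2.dim (f ` V)) \<le> enat (card B)"
    if "finite B" "V \<subseteq> free.span (I \<union> B)" for B
  proof -
    have "f ` V \<subseteq> f ` free.span (I \<union> B)" using that(2) by blast
    also have "\<dots> = L.vs2.span (f ` I \<union> f ` B)"
      by (simp add: L.span_image[symmetric] image_Un[symmetric])
    also have "\<dots> \<subseteq> L.vs2.span (f ` B)"
      using ker L.vs2.span_zero by (intro L.vs2.span_minimal) (auto intro: L.vs2.span_base)
    finally have "f ` V \<subseteq> L.vs2.span (f ` B)" .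
    then have "L.vs2.dim (f ` V) \<le> card (f ` B)"
      using that(1) by (intro L.vs2.dim_le_card) auto
    also have "\<dots> \<le> card B" using that(1) by (rule card_image_le)
    finally show ?thesis by simp
  qed
  obtain D where D: "D \<subseteq> f ` V" "L.vs2.independent D" "f ` V \<subseteq> L.vs2.span D"
      "card D = L.vs2.dim (f ` V)"
    using L.vs2.basis_exists by blast
  have finD: "finite D"
    using L.vs2.independent_span_bound[OF fin(1) D(2)] D(1) fin(2) by auto
  obtain B where B: "B \<subseteq> V" "finite B" "f ` B = D" "card B = card D"
    using D(1) finD by (metis card_image finite_imageD subset_image_inj)
  have "V \<subseteq> free.span (I \<union> B)"
  proof
    fix v assume "v \<in> V"
    then have "f v \<in> L.vs2.span (f ` B)" using D(3) B(3) by blast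
    then obtain w where w: "w \<in> free.span B" "f v = f w"
      by (auto simp: L.span_image)
    then have "v - w \<in> I" using ker by (auto simp: L.diff)
    then have "v - w \<in> free.span (I \<union> B)" "w \<in> free.span (I \<union> B)"
      using w(1) free.span_mono[of B "I \<union> B"] by (auto intro: free.span_base)
    then show "v \<in> free.span (I \<union> B)" using free.span_add by fastforce
  qed
  then have "quotient_dim I V \<le> enat (card B)"
    unfolding quotient_dim_def using B(2) by (intro INF_lower) auto
  moreover have "enat (L.vs2.dim (f ` V)) \<le> quotient_dim I V"
    unfolding quotient_dim_def using le by (intro INF_greatest) auto
  ultimately show ?thesis using B(4) D(4) by (simp add: antisym)
qed

definition contragredient_dim ::
  "('k::field \<Rightarrow> 'h::ab_group_add \<Rightarrow> 'h) \<Rightarrow> ('n \<Rightarrow> 'h) \<Rightarrow> ('n \<Rightarrow> 'h \<Rightarrow> 'k) \<Rightarrow> ('n \<Rightarrow> bit)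
     \<Rightarrow> int \<Rightarrow> enat" where
  "contragredient_dim sc hv \<alpha> p r = quotient_dim (contragredient_ideal sc hv \<alpha> p) (degree_part r)"

text \<open>Polynomial growth of the dimensions means that they are bounded by a polynomial.\<close>

definition finite_growth ::
  "('k::field \<Rightarrow> 'h::ab_group_add \<Rightarrow> 'h) \<Rightarrow> ('n \<Rightarrow> 'h) \<Rightarrow> ('n \<Rightarrow> 'h \<Rightarrow> 'k) \<Rightarrow> ('n \<Rightarrow> bit)
     \<Rightarrow> bool" where
  "finite_growth sc hv \<alpha> p \<longleftrightarrow>
     (\<exists>q :: nat poly. \<forall>r. contragredient_dim sc hv \<alpha> p r \<le> enat (poly q (nat \<bar>r\<bar>)))"


section \<open>The superalgebras \<open>Q\<^sup>\<plusminus>(m,n,t)\<close>\<close>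

definition Q_matrix :: "'k \<Rightarrow> 'k \<Rightarrow> 'k \<Rightarrow> 'k::field^3^3" where
  "Q_matrix a b c = vector [vector [0, 1, a], vector [b, 0, 1], vector [1, c, 0]]"

definition Q_parity :: "3 \<Rightarrow> bit" where
  "Q_parity i = 1"

definition Q_equations :: "int \<Rightarrow> int \<Rightarrow> int \<Rightarrow> real \<Rightarrow> real \<Rightarrow> real \<Rightarrow> bool" where
  "Q_equations m n t a b c \<longleftrightarrow>
     a \<noteq> 0 \<and> b \<noteq> 0 \<and> c \<noteq> 0 \<and>
     1 + a + 1 / b = of_int m \<and> 1 + b + 1 / c = of_int n \<and> 1 + c + 1 / a = of_int t"

definition Q_minus :: "int \<Rightarrow> int \<Rightarrow> int \<Rightarrow> real \<Rightarrow> real \<Rightarrow> real \<Rightarrow> bool" where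
  "Q_minus m n t a b c \<longleftrightarrow> Q_equations m n t a b c \<and> a < -1 \<and> b < -1 \<and> c < -1"

definition Q_plus :: "int \<Rightarrow> int \<Rightarrow> int \<Rightarrow> real \<Rightarrow> real \<Rightarrow> real \<Rightarrow> bool" where
  "Q_plus m n t a b c \<longleftrightarrow> Q_equations m n t a b c \<and>
     -1 < a \<and> a < 0 \<and> -1 < b \<and> b < 0 \<and> -1 < c \<and> c < 0"

end

theory Submission
  imports Defs
begin

text \<open>
  Let \<open>\<beta> = \<alpha>\<^sub>1 + \<alpha>\<^sub>2 + \<alpha>\<^sub>3\<close>, an odd root. The root spaces of \<open>\<plusminus>\<beta>\<close> contain vectors \<open>e\<close>, \<open>f\<close> with
  \<open>[Y\<^sub>1, e] = 0 = [X\<^sub>1, f]\<close>, and \<open>H = [f, e]\<close> satisfies \<open>\<beta>(H) = -2(1+a)ab mt\<close>,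
  \<open>\<alpha>\<^sub>1(H) = -(1+a)ab(m+t)\<close>. Hence \<open>E = [e, e]\<close> and a multiple \<open>F\<close> of \<open>[f, f]\<close> span a copy of
  \<open>sl\<^sub>2\<close> for which \<open>X\<^sub>1\<close> is a lowest weight vector of weight \<open>q = (m+t)/(2mt)\<close>. Unless
  \<open>m = t = -1\<close>, when one rotates the indices, \<open>-1 < q < 0\<close>, so that the string
  \<open>w\<^sub>n = (ad E)\<^sup>n X\<^sub>1\<close> never ends. With \<open>u\<^sub>n = (ad F)\<^sup>n Y\<^sub>1\<close> one has \<open>[u\<^sub>n, w\<^sub>l] = 0\<close> whenever
  \<open>n\<close> and \<open>l\<close> differ by at least two, while \<open>[u\<^sub>n, w\<^sub>n]\<close> lies in the Cartan space and acts on \<open>w\<^sub>l\<close>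
  by a nonzero multiple, depending only on \<open>n\<close>, of the negative number \<open>n + l + 2nl/q\<close>.
  Applying the \<open>u\<close>s one after the other to iterated brackets of \<open>s\<close> distinct \<open>w\<close>s
  therefore shows that these brackets are linearly independent. About \<open>N\<^sup>s\<close> of them lie in
  degrees \<open>O(N)\<close>, for every \<open>s\<close>, which excludes polynomial growth.

  That this can be seen in the quotient by the greatest ideal meeting the Cartan space trivially
  rests on two standard facts. All ideals are graded and the degree zero part of the presented
  algebra is the Cartan space, so such a greatest ideal exists; and a representation of
  Verma type shows that the relations do not kill Cartan elements on which a simple root is nonzero.
\<close>

section \<open>The free superalgebra and its ideals\<close>

lemma lookup_br_Prod [simp]:
  "Poly_Mapping.lookup (br f g) (Prod s t) = Poly_Mapping.lookup f s * Poly_Mapping.lookup g t"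
proof -
  have "Poly_Mapping.lookup (br f g) (Prod s t) =
    (\<Sum>s'\<in>Poly_Mapping.keys f. \<Sum>t'\<in>Poly_Mapping.keys g.
      if s' = s then if t' = t then Poly_Mapping.lookup f s * Poly_Mapping.lookup g t else 0 else 0)"
    by (auto simp: br_def lookup_sum lookup_single when_def intro!: sum.cong)
  also have "\<dots> = Poly_Mapping.lookup f s * Poly_Mapping.lookup g t"
  proof -
    have "(\<Sum>s'\<in>Poly_Mapping.keys f. \<Sum>t'\<in>Poly_Mapping.keys g.
      if s' = s then if t' = t then Poly_Mapping.lookup f s * Poly_Mapping.lookup g t else 0 else 0) =
      (\<Sum>s'\<in>Poly_Mapping.keys f. if s' = s then Poly_Mapping.lookup f s * Poly_Mapping.lookup g t else 0)"
      by (intro sum.cong) (auto simp: in_keys_iff)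
    then show ?thesis by (auto simp: in_keys_iff)
  qed
  finally show ?thesis .
qed

lemma lookup_br_Gen [simp]: "Poly_Mapping.lookup (br f g) (Gen x) = 0"
  by (simp add: br_def lookup_sum lookup_single)

lemma lookup_br:
  "Poly_Mapping.lookup (br f g) u =
     (case u of Gen x \<Rightarrow> 0 | Prod s t \<Rightarrow> Poly_Mapping.lookup f s * Poly_Mapping.lookup g t)"
  by (cases u) auto

lemma br_add_left: "br (f + g) k = br f k + br g k"
  and br_add_right: "br k (f + g) = br k f + br k g"
  and br_diff_left: "br (f - g) k = br f k - br g k"
  and br_diff_right: "br k (f - g) = br k f - br k g"
  and br_fscale_left: "br (fscale c f) k = fscale c (br f k)"
  and br_fscale_right: "br k (fscale c f) = fscale c (br k f)"
  and br_zero_left [simp]: "br 0 k = 0"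
  and br_zero_right [simp]: "br k 0 = 0"
  by (auto intro!: poly_mapping_eqI simp: lookup_br lookup_add lookup_minus algebra_simps split: monomial.split)

lemma br_single:
  "br (Poly_Mapping.single s c) (Poly_Mapping.single t d) = Poly_Mapping.single (Prod s t) (c * d)"
  by (auto intro!: poly_mapping_eqI simp: lookup_br lookup_single when_def split: monomial.split)

lemma fscale_single: "fscale c (Poly_Mapping.single s d) = Poly_Mapping.single s (c * d)"
  by (auto intro!: poly_mapping_eqI simp: lookup_single when_def)

lemma br_sum_right: "br k (\<Sum>i\<in>A. f i) = (\<Sum>i\<in>A. br k (f i))"
  by (induction A rule: infinite_finite_induct) (auto simp: br_add_right)

text \<open>Reduces linear statements about the free algebra to monomials with coefficient
  1.\<close>

lemma free_alg_induct [case_names add scale monomial]: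
  assumes "\<And>f g. P f \<Longrightarrow> P g \<Longrightarrow> P (f + g)" "\<And>c f. P f \<Longrightarrow> P (fscale c f)"
    and "\<And>s. P (Poly_Mapping.single s 1)"
  shows "P (f :: 'b \<Rightarrow>\<^sub>0 'k::field)"
proof -
  have single: "P (Poly_Mapping.single s c)" for s c
    using assms(2)[OF assms(3), of c s] by (simp add: fscale_single)
  have "P (\<Sum>s\<in>A. Poly_Mapping.single s (Poly_Mapping.lookup f s))" for A
    using single[of undefined 0] assms(1) single
    by (induction A rule: infinite_finite_induct) auto
  moreover have "(\<Sum>s\<in>Poly_Mapping.keys f. Poly_Mapping.single s (Poly_Mapping.lookup f s)) = f"
    by (rule poly_mapping_eqI) (auto simp: lookup_sum lookup_single when_def in_keys_iff)
  ultimately show ?thesis by metis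
qed

lemma free_subspace_alt:
  "free.subspace V \<longleftrightarrow> 0 \<in> V \<and> (\<forall>f\<in>V. \<forall>g\<in>V. f + g \<in> V) \<and> (\<forall>c. \<forall>f\<in>V. fscale c f \<in> V)"
  by (auto simp: free.subspace_def)

text \<open>Truncation to the monomials satisfying \<open>Q\<close>. Parity and degree components
  are instances of it, and homogeneity becomes being fixed by a linear projection.\<close>

lift_definition restr :: "('b \<Rightarrow> bool) \<Rightarrow> ('b \<Rightarrow>\<^sub>0 'k::zero) \<Rightarrow> ('b \<Rightarrow>\<^sub>0 'k)" is
  "\<lambda>Q f s. if Q s then f s else 0"
  by (erule finite_subset[rotated]) auto

declare restr.rep_eq [simp]

lemma restr_add: "restr Q (f + g) = restr Q f + restr Q g"
  and restr_fscale: "restr Q (fscale c f) = fscale c (restr Q f)"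
  and restr_diff: "restr Q (f' - g') = restr Q f' - restr Q g'"
  for f g :: "'b \<Rightarrow>\<^sub>0 'k::field" and f' g' :: "'b \<Rightarrow>\<^sub>0 'k"
  by (auto intro!: poly_mapping_eqI simp: lookup_add lookup_minus)

lemma restr_zero [simp]: "restr Q 0 = 0"
  by (auto intro!: poly_mapping_eqI)

lemma restr_single: "restr Q (Poly_Mapping.single s c) = (if Q s then Poly_Mapping.single s c else 0)"
  by (auto intro!: poly_mapping_eqI simp: lookup_single when_def)

section \<open>Parity and degree components\<close>

abbreviation parity_comp :: "('n \<Rightarrow> bit) \<Rightarrow> bit \<Rightarrow> ('h, 'n, 'k::field) free_alg \<Rightarrow> ('h, 'n, 'k) free_alg"
  where "parity_comp p \<epsilon> \<equiv> restr (\<lambda>s. monomial_parity p s = \<epsilon>)"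

abbreviation degree_comp :: "int \<Rightarrow> ('h, 'n, 'k::field) free_alg \<Rightarrow> ('h, 'n, 'k) free_alg"
  where "degree_comp r \<equiv> restr (\<lambda>s. monomial_degree s = r)"

lemma parity_part_iff: "f \<in> parity_part p \<epsilon> \<longleftrightarrow> parity_comp p \<epsilon> f = f"
  unfolding parity_part_def poly_mapping_eq_iff fun_eq_iff
  by (auto simp: in_keys_iff)

lemma degree_part_iff: "f \<in> degree_part r \<longleftrightarrow> degree_comp r f = f"
  unfolding degree_part_def poly_mapping_eq_iff fun_eq_iff
  by (auto simp: in_keys_iff)

lemma parity_comp_comp: "parity_comp p \<epsilon> (parity_comp p \<delta> f) = (if \<epsilon> = \<delta> then parity_comp p \<epsilon> f else 0)"
  by (auto intro!: poly_mapping_eqI)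

lemma degree_comp_comp: "degree_comp r (degree_comp r' f) = (if r = r' then degree_comp r f else 0)"
  by (auto intro!: poly_mapping_eqI)

lemma parity_comp_part [simp]: "parity_comp p \<epsilon> f \<in> parity_part p \<epsilon>"
  by (simp add: parity_part_iff parity_comp_comp)

lemma parity_comp_other: "f \<in> parity_part p \<epsilon> \<Longrightarrow> parity_comp p \<delta> f = (if \<delta> = \<epsilon> then f else 0)"
  by (metis parity_part_iff parity_comp_comp)

lemma degree_comp_other: "f \<in> degree_part r \<Longrightarrow> degree_comp r' f = (if r' = r then f else 0)"
  by (metis degree_part_iff degree_comp_comp)

lemma parity_decomp: "f = parity_comp p 0 f + parity_comp p 1 f"
proof (rule poly_mapping_eqI)
  fix s
  show "Poly_Mapping.lookup f s = Poly_Mapping.lookup (parity_comp p 0 f + parity_comp p 1 f) s"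
    by (cases "monomial_parity p s") (auto simp: lookup_add)
qed

lemma parity_comp_br:
  "parity_comp p \<epsilon> (br f g) =
     br (parity_comp p 0 f) (parity_comp p \<epsilon> g) + br (parity_comp p 1 f) (parity_comp p (\<epsilon> + 1) g)"
proof (rule poly_mapping_eqI)
  fix u
  show "Poly_Mapping.lookup (parity_comp p \<epsilon> (br f g)) u = Poly_Mapping.lookup
    (br (parity_comp p 0 f) (parity_comp p \<epsilon> g) + br (parity_comp p 1 f) (parity_comp p (\<epsilon> + 1) g)) u"
  proof (cases u)
    case (Prod s t)
    then show ?thesis
      by (cases "monomial_parity p s"; cases "monomial_parity p t"; cases \<epsilon>) (auto simp: lookup_add)
  qed (auto simp: lookup_add)
qed

lemma br_parity_part:
  assumes "f \<in> parity_part p \<epsilon>" "g \<in> parity_part p \<delta>"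
  shows "br f g \<in> parity_part p (\<epsilon> + \<delta>)"
  unfolding parity_part_iff parity_comp_br parity_comp_other[OF assms(1)] parity_comp_other[OF assms(2)]
  by (cases \<epsilon>; cases \<delta>) auto

lemma degree_comp_br_left:
  assumes "f \<in> degree_part r"
  shows "degree_comp r' (br f g) = br f (degree_comp (r' - r) g)"
proof (rule poly_mapping_eqI)
  fix u
  have *: "Poly_Mapping.lookup f s = 0" if "monomial_degree s \<noteq> r" for s
    using assms that by (auto simp: degree_part_def in_keys_iff)
  show "Poly_Mapping.lookup (degree_comp r' (br f g)) u =
    Poly_Mapping.lookup (br f (degree_comp (r' - r) g)) u"
  proof (cases u)
    case (Prod s t)
    then show ?thesis using *[of s] by auto
  qed auto
qed

lemma br_degree_part:
  assumes "f \<in> degree_part r" "g \<in> degree_part s"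
  shows "br f g \<in> degree_part (r + s)"
  unfolding degree_part_iff degree_comp_br_left[OF assms(1)] degree_comp_other[OF assms(2)] by simp

lemma subspace_parity_part: "free.subspace (parity_part p \<epsilon>)"
  and subspace_degree_part: "free.subspace (degree_part r)"
  by (auto simp: free_subspace_alt parity_part_iff degree_part_iff restr_add restr_fscale)

lemma gen_parity_part [simp]: "gen g \<in> parity_part p \<epsilon> \<longleftrightarrow> gen_parity p g = \<epsilon>"
  and gen_degree_part [simp]: "gen g \<in> degree_part r \<longleftrightarrow> gen_degree g = r"
  by (auto simp: parity_part_def degree_part_def gen_def)

lemma single_parity_part: "Poly_Mapping.single s c \<in> parity_part p (monomial_parity p s)"
  by (auto simp: parity_part_def)

text \<open>Decompositions into an even and an odd part are unique, so the existential clause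
  amounts to closure under the two projections. In this form the property passes to intersections
  and sums.\<close>

lemma super_ideal_alt:
  "super_ideal p J \<longleftrightarrow> free.subspace J \<and> (\<forall>f\<in>J. \<forall>g. br f g \<in> J \<and> br g f \<in> J) \<and>
     (\<forall>f\<in>J. \<forall>\<epsilon>. parity_comp p \<epsilon> f \<in> J)"
proof -
  have "(\<exists>f0\<in>J \<inter> parity_part p 0. \<exists>f1\<in>J \<inter> parity_part p 1. f = f0 + f1) \<longleftrightarrow>
     (\<forall>\<epsilon>. parity_comp p \<epsilon> f \<in> J)" if "free.subspace J" for f
  proof
    assume "\<exists>f0\<in>J \<inter> parity_part p 0. \<exists>f1\<in>J \<inter> parity_part p 1. f = f0 + f1"
    then obtain f0 f1 where f: "f0 \<in> J" "f1 \<in> J" "f0 \<in> parity_part p 0" "f1 \<in> parity_part p 1"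
      "f = f0 + f1" by auto
    show "\<forall>\<epsilon>. parity_comp p \<epsilon> f \<in> J"
    proof
      fix \<epsilon>
      show "parity_comp p \<epsilon> f \<in> J"
        by (cases \<epsilon>) (use f in \<open>auto simp: restr_add parity_comp_other[OF f(3)] parity_comp_other[OF f(4)]\<close>)
    qed
  next
    assume "\<forall>\<epsilon>. parity_comp p \<epsilon> f \<in> J"
    then show "\<exists>f0\<in>J \<inter> parity_part p 0. \<exists>f1\<in>J \<inter> parity_part p 1. f = f0 + f1"
      by (intro bexI[of _ "parity_comp p 0 f"] bexI[of _ "parity_comp p 1 f"] parity_decomp) auto
  qed
  then show ?thesis unfolding super_ideal_def by blast
qed

lemma
  assumes "super_ideal p J"
  shows super_ideal_subspace: "free.subspace J"
    and super_ideal_br_left: "f \<in> J \<Longrightarrow> br f g \<in> J"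
    and super_ideal_br_right: "f \<in> J \<Longrightarrow> br g f \<in> J"
  using assms by (auto simp: super_ideal_alt)

lemma super_ideal_Inter: "(\<And>J. J \<in> \<J> \<Longrightarrow> super_ideal p J) \<Longrightarrow> super_ideal p (\<Inter>\<J>)"
  unfolding super_ideal_alt by (auto simp: free_subspace_alt)

lemma super_ideal_span_Union:
  assumes "\<And>J. J \<in> \<J> \<Longrightarrow> super_ideal p J"
  shows "super_ideal p (free.span (\<Union>\<J>))"
proof -
  have "br f g \<in> free.span (\<Union>\<J>) \<and> br g f \<in> free.span (\<Union>\<J>) \<and> parity_comp p \<epsilon> f \<in> free.span (\<Union>\<J>)"
    if "f \<in> free.span (\<Union>\<J>)" for f g \<epsilon>
    using that
  proof (induction rule: free.span_induct_alt)
    case base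
    then show ?case by (auto intro: free.span_zero)
  next
    case (step c x y)
    then obtain J where J: "J \<in> \<J>" "x \<in> J" by auto
    have "br x g \<in> \<Union>\<J>" "br g x \<in> \<Union>\<J>" "parity_comp p \<epsilon> x \<in> \<Union>\<J>"
      using assms[OF J(1)] J unfolding super_ideal_alt by blast+
    then show ?case using step
      by (auto simp: br_add_left br_add_right br_fscale_left br_fscale_right restr_add restr_fscale
          intro!: free.span_add free.span_scale intro: free.span_base)
  qed
  then show ?thesis by (auto simp: super_ideal_alt)
qed

lemma relation_ideal_super: "super_ideal p (relation_ideal sc hv \<alpha> p)"
  unfolding relation_ideal_def hull_def by (rule super_ideal_Inter) auto

lemma relators_subset: "relators sc hv \<alpha> p \<subseteq> relation_ideal sc hv \<alpha> p"
  unfolding relation_ideal_def by (rule hull_subset)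

lemma relation_ideal_minimal:
  "super_ideal p J \<Longrightarrow> relators sc hv \<alpha> p \<subseteq> J \<Longrightarrow> relation_ideal sc hv \<alpha> p \<subseteq> J"
  unfolding relation_ideal_def by (rule hull_minimal)

section \<open>Triangular decomposition\<close>

text \<open>The carrier is the whole type, and parity is required only of the two arguments that
  produce the sign. The third argument of \<open>jacobi\<close> is arbitrary, so the identity can be
  read as an equation between operators.\<close>

locale lie_superalgebra = vector_space scl for scl :: "'k::field \<Rightarrow> 'v::ab_group_add \<Rightarrow> 'v" +
  fixes bra :: "'v \<Rightarrow> 'v \<Rightarrow> 'v" and par :: "bit \<Rightarrow> 'v set"
  assumes bra_add_left: "bra (f + g) k = bra f k + bra g k"
    and bra_add_right: "bra k (f + g) = bra k f + bra k g"
    and bra_scale_left: "bra (scl c f) k = scl c (bra f k)"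
    and bra_scale_right: "bra k (scl c f) = scl c (bra k f)"
    and par_bra: "f \<in> par \<epsilon> \<Longrightarrow> g \<in> par \<delta> \<Longrightarrow> bra f g \<in> par (\<epsilon> + \<delta>)"
    and par_add: "f \<in> par \<epsilon> \<Longrightarrow> g \<in> par \<epsilon> \<Longrightarrow> f + g \<in> par \<epsilon>"
    and par_scale: "f \<in> par \<epsilon> \<Longrightarrow> scl c f \<in> par \<epsilon>"
    and skew: "f \<in> par \<epsilon> \<Longrightarrow> g \<in> par \<delta> \<Longrightarrow> bra f g = - scl (super_sign \<epsilon> \<delta>) (bra g f)"
    and jacobi: "f \<in> par \<epsilon> \<Longrightarrow> g \<in> par \<delta> \<Longrightarrow>
      bra f (bra g k) = bra (bra f g) k + scl (super_sign \<epsilon> \<delta>) (bra g (bra f k))"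
begin

lemma bra_zero_left [simp]: "bra 0 k = 0"
  using bra_scale_left[of 0 0 k] by simp

lemma bra_zero_right [simp]: "bra k 0 = 0"
  using bra_scale_right[of k 0 0] by simp

lemma bra_minus_left: "bra (- f) k = - bra f k"
  using bra_scale_left[of "-1" f k] by simp

lemma bra_minus_right: "bra k (- f) = - bra k f"
  using bra_scale_right[of k "-1" f] by simp

lemma bra_diff_left: "bra (f - g) k = bra f k - bra g k"
  using bra_add_left[of f "- g" k] by (simp add: bra_minus_left)

lemma bra_diff_right: "bra k (f - g) = bra k f - bra k g"
  using bra_add_right[of k f "- g"] by (simp add: bra_minus_right)

lemmas bra_simps = bra_add_left bra_add_right bra_scale_left bra_scale_right
  bra_minus_left bra_minus_right bra_diff_left bra_diff_right

lemma skew_even: "f \<in> par 0 \<Longrightarrow> g \<in> par \<delta> \<Longrightarrow> bra g f = - bra f g"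
  using skew[of g \<delta> f 0] by (simp add: super_sign_def)

lemma skew_odd: "f \<in> par 1 \<Longrightarrow> g \<in> par 1 \<Longrightarrow> bra f g = bra g f"
  using skew[of f 1 g 1] by (simp add: super_sign_def)

lemma jacobi_even: "f \<in> par 0 \<Longrightarrow> g \<in> par \<delta> \<Longrightarrow> bra f (bra g k) = bra (bra f g) k + bra g (bra f k)"
  using jacobi[of f 0 g \<delta> k] by (simp add: super_sign_def)

lemma jacobi_odd_even: "f \<in> par 1 \<Longrightarrow> g \<in> par 0 \<Longrightarrow> bra f (bra g k) = bra (bra f g) k + bra g (bra f k)"
  using jacobi[of f 1 g 0 k] by (simp add: super_sign_def)

lemma jacobi_odd: "f \<in> par 1 \<Longrightarrow> g \<in> par 1 \<Longrightarrow> bra f (bra g k) = bra (bra f g) k - bra g (bra f k)"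
  using jacobi[of f 1 g 1 k] by (simp add: super_sign_def)

end

text \<open>Elements satisfying the defining relations in some Lie superalgebra, which they need not
  generate. Every quotient by an ideal containing the relators becomes an instance.\<close>

locale contragredient_algebra = lie_superalgebra scl bra par
  for scl :: "'k::field \<Rightarrow> 'v::ab_group_add \<Rightarrow> 'v" and bra par +
  fixes sc :: "'k \<Rightarrow> 'h::ab_group_add \<Rightarrow> 'h" and hv :: "'n \<Rightarrow> 'h" and \<alpha> :: "'n \<Rightarrow> 'h \<Rightarrow> 'k"
    and p :: "'n \<Rightarrow> bit" and cart :: "'h \<Rightarrow> 'v" and x y :: "'n \<Rightarrow> 'v"
  assumes cart_add: "cart (h + h') = cart h + cart h'"
    and cart_scale: "cart (sc c h) = scl c (cart h)"
    and cart_even: "cart h \<in> par 0"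
    and x_par: "x i \<in> par (p i)"
    and y_par: "y i \<in> par (p i)"
    and cart_cart: "bra (cart h) (cart h') = 0"
    and cart_x: "bra (cart h) (x i) = scl (\<alpha> i h) (x i)"
    and cart_y: "bra (cart h) (y i) = scl (- \<alpha> i h) (y i)"
    and x_y: "bra (x i) (y j) = (if i = j then cart (hv i) else 0)"
begin

lemma cart_zero [simp]: "cart 0 = 0"
  using cart_add[of 0 0] by simp

lemma x_cart: "bra (x i) (cart h) = scl (- \<alpha> i h) (x i)"
  using skew_even[OF cart_even x_par, of i h] by (simp add: cart_x)

lemma y_cart: "bra (y i) (cart h) = scl (\<alpha> i h) (y i)"
  using skew_even[OF cart_even y_par, of i h] by (simp add: cart_y)

lemma y_x_cart: "\<exists>h. bra (y j) (x i) = cart h"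
proof -
  have "bra (y j) (x i) = - scl (super_sign (p j) (p i)) (if i = j then cart (hv i) else 0)"
    using skew[OF y_par x_par, of j i] by (simp add: x_y)
  also have "\<dots> = cart (sc (- super_sign (p j) (p i)) (if i = j then hv i else 0))"
    by (simp add: cart_scale)
  finally show ?thesis by blast
qed

lemma x_y_cart: "\<exists>h. bra (x j) (y i) = cart h"
  using x_y[of j i] cart_zero by metis

text \<open>For \<open>x\<close> or \<open>y\<close> in place of \<open>z\<close> this is the span
  of all right-nested brackets of generators, that is, the positive or the negative part.\<close>

inductive_set ladder :: "('n \<Rightarrow> 'v) \<Rightarrow> 'v set" for z where
  base: "z i \<in> ladder z"
| step: "f \<in> ladder z \<Longrightarrow> bra (z i) f \<in> ladder z"
| add: "f \<in> ladder z \<Longrightarrow> g \<in> ladder z \<Longrightarrow> f + g \<in> ladder z"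
| scale: "f \<in> ladder z \<Longrightarrow> scl c f \<in> ladder z"

lemma ladder_zero: "0 \<in> ladder z"
  using ladder.scale[OF ladder.base[of z undefined], of 0] by simp

lemma cart_ladder:
  assumes f: "f \<in> ladder z" and z: "\<And>i. z i \<in> par (p i)" "\<And>i. \<exists>c. bra (cart h) (z i) = scl c (z i)"
  shows "bra (cart h) f \<in> ladder z"
  using f
proof induction
  case (base i)
  show ?case using z(2)[of i] ladder.scale[OF ladder.base] by metis
next
  case (step f i)
  obtain c where c: "bra (cart h) (z i) = scl c (z i)" using z(2) by blast
  show ?case
    unfolding jacobi_even[OF cart_even z(1)] c bra_scale_left
    by (intro ladder.add ladder.scale ladder.step step)
qed (auto simp: bra_simps intro: ladder.intros)

text \<open>By Jacobi, a Cartan term created further inside becomes a multiple of \<open>z i\<close>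
  under the next bracket, and one created at the outermost letter acts within the ladder. A Cartan
  part thus survives only for a single generator.\<close>

lemma lower_ladder:
  assumes f: "f \<in> ladder z" and z: "\<And>i. z i \<in> par (p i)" "\<And>i h. \<exists>c. bra (cart h) (z i) = scl c (z i)"
    and z': "z' \<in> par \<epsilon>" "\<And>i. \<exists>h. bra z' (z i) = cart h"
  shows "\<exists>h. \<exists>g\<in>ladder z. bra z' f = cart h + g"
  using f
proof induction
  case (base i)
  obtain h where "bra z' (z i) = cart h" using z'(2) by blast
  then show ?case using ladder_zero[of z] by (intro exI[of _ h] bexI[of _ 0]) auto
next
  case (step f i)
  obtain h where h: "bra z' (z i) = cart h" using z'(2) by blast
  obtain h' g where g: "g \<in> ladder z" "bra z' f = cart h' + g" using step by blast
  obtain c where c: "bra (cart h') (z i) = scl c (z i)" using z(2) by blast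
  have c': "bra (z i) (cart h') = scl (- c) (z i)" using skew_even[OF cart_even z(1)] c by simp
  have "bra z' (bra (z i) f) \<in> ladder z"
    unfolding jacobi[OF z'(1) z(1)] h g(2) bra_add_right c'
    by (intro ladder.intros cart_ladder step g z)
  then show ?case using cart_zero by (intro exI[of _ 0] bexI[of _ "bra z' (bra (z i) f)"]) auto
next
  case (add f g)
  then obtain h1 g1 h2 g2 where "g1 \<in> ladder z" "bra z' f = cart h1 + g1" "g2 \<in> ladder z"
    "bra z' g = cart h2 + g2" by metis
  then have "g1 + g2 \<in> ladder z" "bra z' (f + g) = cart (h1 + h2) + (g1 + g2)"
    by (auto simp: bra_simps cart_add intro: ladder.add)
  then show ?case by blast
next
  case (scale f c)
  then obtain h1 g1 where "g1 \<in> ladder z" "bra z' f = cart h1 + g1" by metis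
  then have "scl c g1 \<in> ladder z" "bra z' (scl c f) = cart (sc c h1) + scl c g1"
    by (auto simp: bra_simps cart_scale scale_right_distrib intro: ladder.scale)
  then show ?case by blast
qed

definition triangular :: "'v set" where
  "triangular = {f + cart h + g | f h g. f \<in> ladder y \<and> g \<in> ladder x}"

lemma triangularI: "f \<in> ladder y \<Longrightarrow> g \<in> ladder x \<Longrightarrow> f + cart h + g \<in> triangular"
  by (auto simp: triangular_def)

lemma triangular_gens: "cart h \<in> triangular" "x i \<in> triangular" "y i \<in> triangular"
  using triangularI[OF ladder_zero ladder_zero, of h] triangularI[OF ladder_zero ladder.base, of 0 i]
    triangularI[OF ladder.base ladder_zero, of i 0] by auto

lemma triangular_add: "f \<in> triangular \<Longrightarrow> g \<in> triangular \<Longrightarrow> f + g \<in> triangular"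
proof -
  assume "f \<in> triangular" "g \<in> triangular"
  then obtain f1 h1 g1 f2 h2 g2 where *: "f1 \<in> ladder y" "g1 \<in> ladder x" "f = f1 + cart h1 + g1"
    "f2 \<in> ladder y" "g2 \<in> ladder x" "g = f2 + cart h2 + g2"
    unfolding triangular_def by blast
  have "f + g = (f1 + f2) + cart (h1 + h2) + (g1 + g2)" using * by (simp add: cart_add algebra_simps)
  also have "\<dots> \<in> triangular" by (intro triangularI ladder.add *)
  finally show ?thesis .
qed

lemma triangular_scale: "f \<in> triangular \<Longrightarrow> scl c f \<in> triangular"
proof -
  assume "f \<in> triangular"
  then obtain f1 h1 g1 where *: "f1 \<in> ladder y" "g1 \<in> ladder x" "f = f1 + cart h1 + g1"
    unfolding triangular_def by blast
  have "scl c f = scl c f1 + cart (sc c h1) + scl c g1"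
    using * by (simp add: cart_scale scale_right_distrib)
  also have "\<dots> \<in> triangular" by (intro triangularI ladder.scale *)
  finally show ?thesis .
qed

lemma triangular_diff: "f \<in> triangular \<Longrightarrow> g \<in> triangular \<Longrightarrow> f - g \<in> triangular"
  using triangular_add[of f "scl (-1) g"] triangular_scale[of g "-1"] by simp

lemma ladder_triangular: "f \<in> ladder y \<Longrightarrow> f \<in> triangular" "g \<in> ladder x \<Longrightarrow> g \<in> triangular"
  using triangularI[of f 0 0] triangularI[of 0 g 0] ladder_zero by auto

lemma triangular_stable:
  assumes "f \<in> triangular"
  shows "bra (cart h) f \<in> triangular" "bra (x i) f \<in> triangular" "bra (y i) f \<in> triangular"
proof -
  obtain f1 h1 g1 where *: "f1 \<in> ladder y" "g1 \<in> ladder x" "f = f1 + cart h1 + g1"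
    using assms unfolding triangular_def by blast
  have cx: "\<exists>c. bra (cart h) (x i) = scl c (x i)" and cy: "\<exists>c. bra (cart h) (y i) = scl c (y i)" for h i
    using cart_x cart_y by blast+
  show "bra (cart h) f \<in> triangular"
    unfolding * bra_add_right cart_cart using ladder_triangular(2)[OF ladder_zero]
    by (intro triangular_add ladder_triangular(1)[OF cart_ladder[OF *(1) y_par cy]]
        ladder_triangular(2)[OF cart_ladder[OF *(2) x_par cx]])
  have t: "z \<in> triangular" if "\<exists>h. \<exists>g\<in>ladder x. z = cart h + g" for z
    using that ladder_triangular(2) triangular_gens(1) triangular_add by metis
  have t': "z \<in> triangular" if "\<exists>h. \<exists>g\<in>ladder y. z = cart h + g" for z
    using that ladder_triangular(1) triangular_gens(1) triangular_add by metis
  show "bra (x i) f \<in> triangular"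
    unfolding * bra_add_right x_cart
    by (intro triangular_add t' lower_ladder[OF *(1) y_par cy x_par x_y_cart]
        ladder_triangular(2) ladder.step ladder.scale ladder.base *)
  show "bra (y i) f \<in> triangular"
    unfolding * bra_add_right y_cart
    by (intro triangular_add t lower_ladder[OF *(2) x_par cx y_par y_x_cart]
        ladder_triangular(1) ladder.step ladder.scale ladder.base *)
qed

text \<open>By Jacobi, the elements whose adjoint action preserves a subspace are closed under
  brackets. This carries stability from the generators to all monomials.\<close>

lemma triangular_stable_bra:
  assumes "f \<in> par \<epsilon>" "g \<in> par \<delta>" "\<And>k. k \<in> triangular \<Longrightarrow> bra f k \<in> triangular"
    "\<And>k. k \<in> triangular \<Longrightarrow> bra g k \<in> triangular" "k \<in> triangular"
  shows "bra (bra f g) k \<in> triangular"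
proof -
  have "bra (bra f g) k = bra f (bra g k) - scl (super_sign \<epsilon> \<delta>) (bra g (bra f k))"
    using jacobi[OF assms(1,2), of k] by simp
  then show ?thesis using assms(3-5) by (simp add: triangular_diff triangular_scale)
qed

end

section \<open>Quotients of the free superalgebra\<close>

lemma relatorsI:
  shows "gen (Cartan (u + v)) - gen (Cartan u) - gen (Cartan v) \<in> relators sc hv \<alpha> p"
    and "gen (Cartan (sc c u)) - fscale c (gen (Cartan u)) \<in> relators sc hv \<alpha> p"
    and "f \<in> parity_part p \<epsilon> \<Longrightarrow> g \<in> parity_part p \<delta> \<Longrightarrow>
      br f g + fscale (super_sign \<epsilon> \<delta>) (br g f) \<in> relators sc hv \<alpha> p"
    and "f \<in> parity_part p \<epsilon> \<Longrightarrow> g \<in> parity_part p \<delta> \<Longrightarrow>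
      br f (br g k) - br (br f g) k - fscale (super_sign \<epsilon> \<delta>) (br g (br f k)) \<in> relators sc hv \<alpha> p"
    and "br (gen (Cartan u)) (gen (Cartan v)) \<in> relators sc hv \<alpha> p"
    and "br (gen (Cartan u)) (gen (X i)) - fscale (\<alpha> i u) (gen (X i)) \<in> relators sc hv \<alpha> p"
    and "br (gen (Cartan u)) (gen (Y i)) + fscale (\<alpha> i u) (gen (Y i)) \<in> relators sc hv \<alpha> p"
    and "br (gen (X i)) (gen (Y j)) - (if i = j then gen (Cartan (hv i)) else 0) \<in> relators sc hv \<alpha> p"
  unfolding relators_def Un_iff mem_Collect_eq by metis+

text \<open>The quotient by \<open>J\<close> is modelled inside the free algebra, as the image of a linear projection
  \<open>nf\<close> with kernel \<open>J\<close>, so that congruences modulo \<open>J\<close> become equations.\<close>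

locale quotient_projection =
  fixes sc :: "'k::field_char_0 \<Rightarrow> 'h::ab_group_add \<Rightarrow> 'h" and hv :: "'n \<Rightarrow> 'h"
    and \<alpha> :: "'n \<Rightarrow> 'h \<Rightarrow> 'k" and p :: "'n \<Rightarrow> bit"
    and J :: "('h, 'n, 'k) free_alg set" and nf :: "('h, 'n, 'k) free_alg \<Rightarrow> ('h, 'n, 'k) free_alg"
  assumes ideal: "super_ideal p J" and relators: "relators sc hv \<alpha> p \<subseteq> J"
    and nf_add: "nf (f + g) = nf f + nf g" and nf_scale: "nf (fscale c f) = fscale c (nf f)"
    and nf_nf [simp]: "nf (nf f) = nf f" and nf_eq_0: "nf f = 0 \<longleftrightarrow> f \<in> J"
begin

lemma nf_diff: "nf (f - g) = nf f - nf g"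
  using nf_add[of "f - g" g] by (simp add: algebra_simps)

lemma nf_zero [simp]: "nf 0 = 0"
  using nf_scale[of 0 0] by simp

lemma nf_sum: "nf (\<Sum>i\<in>A. f i) = (\<Sum>i\<in>A. nf (f i))"
  by (induction A rule: infinite_finite_induct) (auto simp: nf_add)

lemma nf_eq: "nf f = nf g \<longleftrightarrow> f - g \<in> J"
  using nf_eq_0[of "f - g"] by (simp add: nf_diff)

lemma nf_br_left [simp]: "nf (br (nf f) g) = nf (br f g)"
proof -
  have "nf f - f \<in> J" using nf_eq[of "nf f" f] by simp
  then have "br (nf f - f) g \<in> J" using super_ideal_br_left[OF ideal] by blast
  then show ?thesis by (simp add: nf_eq br_diff_left)
qed

lemma nf_br_right [simp]: "nf (br f (nf g)) = nf (br f g)"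
proof -
  have "nf g - g \<in> J" using nf_eq[of "nf g" g] by simp
  then have "br f (nf g - g) \<in> J" using super_ideal_br_right[OF ideal] by blast
  then show ?thesis by (simp add: nf_eq br_diff_right)
qed

lemma relatorD: "f \<in> relators sc hv \<alpha> p \<Longrightarrow> nf f = 0"
  using relators nf_eq_0 by blast

text \<open>Skew symmetry, Jacobi and the defining relations hold because \<open>nf\<close> kills
  the relators. The homogeneous elements are the images of the homogeneous elements of the free
  algebra.\<close>

sublocale contragredient_algebra fscale "\<lambda>f g. nf (br f g)" "\<lambda>\<epsilon>. nf ` parity_part p \<epsilon>"
  sc hv \<alpha> p "\<lambda>h. nf (gen (Cartan h))" "\<lambda>i. nf (gen (X i))" "\<lambda>i. nf (gen (Y i))"
proof unfold_locales
  fix f g k and c :: 'k and \<epsilon> \<delta>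
  show "nf (br (f + g) k) = nf (br f k) + nf (br g k)" "nf (br k (f + g)) = nf (br k f) + nf (br k g)"
    "nf (br (fscale c f) k) = fscale c (nf (br f k))" "nf (br k (fscale c f)) = fscale c (nf (br k f))"
    by (simp_all add: br_add_left br_add_right nf_add br_fscale_left br_fscale_right nf_scale)
  show "fscale c f \<in> nf ` parity_part p \<epsilon>" if f: "f \<in> nf ` parity_part p \<epsilon>"
  proof -
    obtain f' where "f' \<in> parity_part p \<epsilon>" "f = nf f'" using f by blast
    then show ?thesis using free.subspace_scale[OF subspace_parity_part]
      by (intro image_eqI[of _ _ "fscale c f'"]) (auto simp: nf_scale)
  qed
  assume f: "f \<in> nf ` parity_part p \<epsilon>"
  then obtain f' where f': "f' \<in> parity_part p \<epsilon>" "f = nf f'" by blast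
  show "f + g \<in> nf ` parity_part p \<epsilon>" if "g \<in> nf ` parity_part p \<epsilon>"
  proof -
    obtain g' where "g' \<in> parity_part p \<epsilon>" "g = nf g'" using \<open>g \<in> nf ` parity_part p \<epsilon>\<close> by blast
    then show ?thesis using f' free.subspace_add[OF subspace_parity_part]
      by (intro image_eqI[of _ _ "f' + g'"]) (auto simp: nf_add)
  qed
  assume g: "g \<in> nf ` parity_part p \<delta>"
  then obtain g' where g': "g' \<in> parity_part p \<delta>" "g = nf g'" by blast
  show "nf (br f g) \<in> nf ` parity_part p (\<epsilon> + \<delta>)"
    using br_parity_part[OF f'(1) g'(1)] f' g' by auto
  have "br f' g' + fscale (super_sign \<epsilon> \<delta>) (br g' f') \<in> relators sc hv \<alpha> p"
    using f'(1) g'(1) by (rule relatorsI)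
  from relatorD[OF this] show "nf (br f g) = - fscale (super_sign \<epsilon> \<delta>) (nf (br g f))"
    by (simp add: f' g' nf_add nf_scale eq_neg_iff_add_eq_0)
  have "br f' (br g' k) - br (br f' g') k - fscale (super_sign \<epsilon> \<delta>) (br g' (br f' k)) \<in> relators sc hv \<alpha> p"
    using f'(1) g'(1) by (rule relatorsI)
  from relatorD[OF this] show "nf (br f (nf (br g k))) =
       nf (br (nf (br f g)) k) + fscale (super_sign \<epsilon> \<delta>) (nf (br g (nf (br f k))))"
    by (simp add: f' g' nf_diff nf_scale nf_br_right[of _ "br (nf _) _", symmetric]
        nf_br_left[of "br _ (nf _)", symmetric] del: nf_br_right nf_br_left)
       (simp add: algebra_simps)
next
  fix h h' :: 'h and c :: 'k and i j :: 'n
  have "gen (Cartan (h + h')) - gen (Cartan h) - gen (Cartan h') \<in> relators sc hv \<alpha> p"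
    by (rule relatorsI)
  from relatorD[OF this] show "nf (gen (Cartan (h + h'))) = nf (gen (Cartan h)) + nf (gen (Cartan h'))"
    by (simp add: nf_diff nf_add algebra_simps)
  have "gen (Cartan (sc c h)) - fscale c (gen (Cartan h)) \<in> relators sc hv \<alpha> p"
    by (rule relatorsI)
  from relatorD[OF this] show "nf (gen (Cartan (sc c h))) = fscale c (nf (gen (Cartan h)))"
    by (simp add: nf_diff nf_scale)
  have "br (gen (Cartan h)) (gen (Cartan h')) \<in> relators sc hv \<alpha> p"
    by (rule relatorsI)
  from relatorD[OF this] show "nf (br (nf (gen (Cartan h))) (nf (gen (Cartan h')))) = 0"
    by simp
  have "br (gen (Cartan h)) (gen (X i)) - fscale (\<alpha> i h) (gen (X i)) \<in> relators sc hv \<alpha> p"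
    by (rule relatorsI)
  from relatorD[OF this]
  show "nf (br (nf (gen (Cartan h))) (nf (gen (X i)))) = fscale (\<alpha> i h) (nf (gen (X i)))"
    by (simp add: nf_diff nf_scale)
  have "br (gen (Cartan h)) (gen (Y i)) + fscale (\<alpha> i h) (gen (Y i)) \<in> relators sc hv \<alpha> p"
    by (rule relatorsI)
  from relatorD[OF this]
  show "nf (br (nf (gen (Cartan h))) (nf (gen (Y i)))) = fscale (- \<alpha> i h) (nf (gen (Y i)))"
    by (simp add: nf_add nf_scale eq_neg_iff_add_eq_0)
  have "br (gen (X i)) (gen (Y j)) - (if i = j then gen (Cartan (hv i)) else 0) \<in> relators sc hv \<alpha> p"
    by (rule relatorsI)
  from relatorD[OF this]
  show "nf (br (nf (gen (X i))) (nf (gen (Y j)))) = (if i = j then nf (gen (Cartan (hv i))) else 0)"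
    by (simp add: nf_diff split: if_splits)
qed (auto intro!: imageI)

end

lemma single_Gen: "Poly_Mapping.single (Gen g) 1 = gen g"
  by (simp add: gen_def)

text \<open>A basis of \<open>J\<close> is extended to a basis of the whole space; \<open>nf\<close>
  kills the former and fixes the vectors added.\<close>

lemma exists_quotient_projection:
  fixes J :: "('b \<Rightarrow>\<^sub>0 'k::field) set"
  assumes J: "free.subspace J"
  obtains nf :: "('b \<Rightarrow>\<^sub>0 'k) \<Rightarrow> ('b \<Rightarrow>\<^sub>0 'k)" where
    "\<And>f g. nf (f + g) = nf f + nf g" "\<And>c f. nf (fscale c f) = fscale c (nf f)"
    "\<And>f. nf (nf f) = nf f" "\<And>f. nf f = 0 \<longleftrightarrow> f \<in> J"
proof -
  interpret vp: vector_space_pair "fscale :: 'k \<Rightarrow> ('b \<Rightarrow>\<^sub>0 'k) \<Rightarrow> ('b \<Rightarrow>\<^sub>0 'k)" "fscale :: 'k \<Rightarrow> ('b \<Rightarrow>\<^sub>0 'k) \<Rightarrow> ('b \<Rightarrow>\<^sub>0 'k)" ..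
  obtain B where B: "B \<subseteq> J" "free.independent B" "J \<subseteq> free.span B"
    using free.basis_exists[of J] by metis
  define B' where "B' = free.extend_basis B"
  have B': "free.independent B'" "free.span B' = UNIV"
    using free.independent_extend_basis[OF B(2)] free.span_extend_basis[OF B(2)] by (auto simp: B'_def)
  obtain nf where nf: "Vector_Spaces.linear fscale fscale nf" "\<forall>f\<in>B'. nf f = (if f \<in> B then 0 else f)"
    using vp.linear_independent_extend[OF B'(1), of "\<lambda>f. if f \<in> B then 0 else f"] by blast
  interpret nf: Vector_Spaces.linear fscale fscale nf by (rule nf(1))
  have diff: "f - nf f \<in> J" for f
  proof -
    have "f \<in> free.span B'" using B'(2) by simp
    then show ?thesis
    proof (induction rule: free.span_induct_alt)
      case base
      show ?case using free.subspace_0[OF J] by simp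
    next
      case (step c f g)
      have "f - nf f \<in> J" using nf(2) step(1) B(1) free.subspace_0[OF J] by auto
      then have "fscale c (f - nf f) + (g - nf g) \<in> J"
        using step(2) free.subspace_add[OF J] free.subspace_scale[OF J] by blast
      then show ?case by (simp add: nf.add nf.scale free.scale_right_diff_distrib algebra_simps)
    qed
  qed
  have B_sub: "B \<subseteq> B'" using free.extend_basis_superset[OF B(2)] by (simp add: B'_def)
  have zero: "nf f = 0" if "f \<in> J" for f
  proof -
    have "f \<in> free.span B" using B(3) that by blast
    then show ?thesis
      by (induction rule: free.span_induct_alt) (use nf(2) B_sub in \<open>auto simp: nf.add nf.scale\<close>)
  qed
  show ?thesis
  proof (rule that)
    show "nf (nf f) = nf f" for f using zero[OF diff[of f]] by (simp add: nf.diff)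
    show "nf f = 0 \<longleftrightarrow> f \<in> J" for f using zero diff[of f] by auto
  qed (simp_all add: nf.add nf.scale)
qed

section \<open>Gradedness of the ideals and the degree zero part\<close>

lemma sum_degree_comp:
  "(\<Sum>r\<in>monomial_degree ` Poly_Mapping.keys f. degree_comp r f) = f"
proof (rule poly_mapping_eqI)
  fix s
  have "Poly_Mapping.lookup (\<Sum>r\<in>monomial_degree ` Poly_Mapping.keys f. degree_comp r f) s =
    (if monomial_degree s \<in> monomial_degree ` Poly_Mapping.keys f then Poly_Mapping.lookup f s else 0)"
    by (simp add: lookup_sum)
  also have "\<dots> = Poly_Mapping.lookup f s" by (auto simp: in_keys_iff)
  finally show "Poly_Mapping.lookup (\<Sum>r\<in>monomial_degree ` Poly_Mapping.keys f. degree_comp r f) s =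
    Poly_Mapping.lookup f s" .
qed

lemma degree_comp_part [simp]: "degree_comp r f \<in> degree_part r"
  by (simp add: degree_part_iff degree_comp_comp)

text \<open>\<open>x\<^sub>0\<close> is a grading element: its adjoint action on degree
  \<open>r\<close> is multiplication by \<open>r\<close>.\<close>

locale graded_quotient_projection = quotient_projection +
  fixes x\<^sub>0
  assumes \<alpha>_x\<^sub>0: "\<alpha> i x\<^sub>0 = 1"
begin

lemma nf_single_Prod: "nf (Poly_Mapping.single (Prod s t) 1) =
    nf (br (nf (Poly_Mapping.single s 1)) (nf (Poly_Mapping.single t 1)))"
  by (simp add: br_single)

lemma degree_monomial:
  "nf (br (gen (Cartan x\<^sub>0)) (Poly_Mapping.single s 1)) =
     fscale (of_int (monomial_degree s)) (nf (Poly_Mapping.single s 1))"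
proof (induction s)
  case (Gen g)
  show ?case
    using cart_cart cart_x cart_y by (cases g) (simp_all add: single_Gen \<alpha>_x\<^sub>0)
next
  case (Prod s t)
  let ?s = "nf (Poly_Mapping.single s 1)" and ?t = "nf (Poly_Mapping.single t 1)"
    and ?c = "nf (gen (Cartan x\<^sub>0))"
  have st: "nf (Poly_Mapping.single (Prod s t) 1) = nf (br ?s ?t)" by (rule nf_single_Prod)
  have "nf (br (gen (Cartan x\<^sub>0)) (Poly_Mapping.single (Prod s t) 1)) = nf (br ?c (nf (br ?s ?t)))"
    unfolding st[symmetric] by simp
  also have "\<dots> = nf (br (nf (br ?c ?s)) ?t) + nf (br ?s (nf (br ?c ?t)))"
    by (rule jacobi_even[OF cart_even imageI[OF single_parity_part]])
  also have "nf (br ?c ?s) = fscale (of_int (monomial_degree s)) ?s" using Prod(1) by simp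
  also have "nf (br ?c ?t) = fscale (of_int (monomial_degree t)) ?t" using Prod(2) by simp
  also have "nf (br (fscale (of_int (monomial_degree s)) ?s) ?t) + nf (br ?s (fscale (of_int (monomial_degree t)) ?t))
    = fscale (of_int (monomial_degree (Prod s t))) (nf (br ?s ?t))"
    by (simp only: bra_scale_left bra_scale_right free.scale_left_distrib[symmetric]
        monomial_degree.simps of_int_add)
  finally show ?case unfolding st .
qed

lemma degree_eigen:
  assumes "f \<in> degree_part r"
  shows "nf (br (gen (Cartan x\<^sub>0)) f) = fscale (of_int r) (nf f)"
proof -
  have "nf (br (gen (Cartan x\<^sub>0)) (degree_comp r f)) = fscale (of_int r) (nf (degree_comp r f))"
    by (induction f rule: free_alg_induct)
       (auto simp: restr_add restr_fscale restr_single br_add_right br_fscale_right nf_add nf_scale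
          free.scale_right_distrib degree_monomial mult.commute)
  then show ?thesis using assms by (simp add: degree_part_iff)
qed

text \<open>The summands are eigenvectors of the grading element for distinct eigenvalues.
  Subtracting \<open>r0\<close> times the sum from its image removes the term of degree
  \<open>r0\<close> and multiplies the others by \<open>r - r0\<close>, which is nonzero in
  characteristic 0.\<close>

lemma sum_homogeneous_mem:
  assumes "finite S" "\<And>r. r \<in> S \<Longrightarrow> z r \<in> degree_part r" "(\<Sum>r\<in>S. z r) \<in> J" "r \<in> S"
  shows "z r \<in> J"
  using assms
proof (induction S arbitrary: z r rule: finite_induct)
  case (insert r0 S)
  have z: "z r \<in> degree_part r" if "r \<in> insert r0 S" for r using insert.prems that by blast
  have sum0: "nf (z r0) + (\<Sum>r\<in>S. nf (z r)) = 0"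
    using insert nf_eq_0[of "\<Sum>r\<in>insert r0 S. z r"] by (simp add: nf_add nf_sum)
  have "nf (br (gen (Cartan x\<^sub>0)) (\<Sum>r\<in>insert r0 S. z r)) = 0"
    using super_ideal_br_right[OF ideal insert.prems(2)] nf_eq_0 by blast
  then have "nf (br (gen (Cartan x\<^sub>0)) (z r0)) + (\<Sum>r\<in>S. nf (br (gen (Cartan x\<^sub>0)) (z r))) = 0"
    using insert.hyps by (simp add: br_add_right br_sum_right nf_add nf_sum)
  moreover have "(\<Sum>r\<in>S. nf (br (gen (Cartan x\<^sub>0)) (z r))) = (\<Sum>r\<in>S. fscale (of_int r) (nf (z r)))"
    by (intro sum.cong refl degree_eigen z) simp
  moreover have "nf (br (gen (Cartan x\<^sub>0)) (z r0)) = fscale (of_int r0) (nf (z r0))"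
    by (intro degree_eigen z) simp
  ultimately have sum1: "fscale (of_int r0) (nf (z r0)) + (\<Sum>r\<in>S. fscale (of_int r) (nf (z r))) = 0"
    by simp
  have "nf (\<Sum>r\<in>S. fscale (of_int (r - r0)) (z r)) =
    (fscale (of_int r0) (nf (z r0)) + (\<Sum>r\<in>S. fscale (of_int r) (nf (z r))))
    - fscale (of_int r0) (nf (z r0) + (\<Sum>r\<in>S. nf (z r)))"
    by (simp add: nf_sum nf_scale nf_diff free.scale_left_diff_distrib sum_subtractf free.scale_sum_right
        free.scale_right_distrib)
  then have sum_J: "(\<Sum>r\<in>S. fscale (of_int (r - r0)) (z r)) \<in> J"
    using sum0 sum1 nf_eq_0[of "\<Sum>r\<in>S. fscale (of_int (r - r0)) (z r)"] by simp
  have in_S: "fscale (of_int (r - r0)) (z r) \<in> J" if "r \<in> S" for r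
    using z by (intro insert.IH[of "\<lambda>r. fscale (of_int (r - r0)) (z r)", OF _ sum_J that]
      free.subspace_scale[OF subspace_degree_part]) auto
  have S: "nf (z r) = 0" if "r \<in> S" for r
  proof -
    have "of_int (r - r0) \<noteq> (0::'a)" using insert.hyps(2) that by auto
    moreover have "fscale (of_int (r - r0)) (nf (z r)) = 0" using in_S[OF that] nf_eq_0 nf_scale by metis
    ultimately show ?thesis using free.scale_eq_0_iff by blast
  qed
  then have "nf (z r0) = 0" using sum0 by simp
  then show ?case using S insert.prems(3) nf_eq_0 by auto
qed simp

lemma degree_comp_mem: "f \<in> J \<Longrightarrow> degree_comp r f \<in> J"
proof (cases "r \<in> monomial_degree ` Poly_Mapping.keys f")
  case True
  assume "f \<in> J"
  then show ?thesis
    using True by (intro sum_homogeneous_mem[of "monomial_degree ` Poly_Mapping.keys f" "\<lambda>r. degree_comp r f"])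
      (auto simp: sum_degree_comp)
next
  case False
  have "degree_comp r f = 0" using False by (intro poly_mapping_eqI) (auto simp: in_keys_iff)
  then show ?thesis using free.subspace_0[OF super_ideal_subspace[OF ideal]] by simp
qed

lemma nf_triangular: "nf f \<in> triangular"
proof -
  \<comment> \<open>The left factor of a product acts as an operator. Once all monomials are known
    to preserve \<open>triangular\<close>, only the right factor has to lie in it.\<close>
  have stable: "\<forall>k\<in>triangular. nf (br (nf (Poly_Mapping.single s 1)) k) \<in> triangular" for s
  proof (induction s)
    case (Gen g)
    show ?case using triangular_stable by (cases g) (auto simp: single_Gen)
  next
    case (Prod s t)
    show ?case unfolding nf_single_Prod
      using Prod by (intro ballI triangular_stable_bra[OF imageI[OF single_parity_part] imageI[OF single_parity_part]]) auto
  qed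
  have mono: "nf (Poly_Mapping.single s 1) \<in> triangular" for s
  proof (induction s)
    case (Gen g)
    show ?case using triangular_gens by (cases g) (auto simp: single_Gen)
  next
    case (Prod s t)
    show ?case unfolding nf_single_Prod using stable[of s] Prod by blast
  qed
  show ?thesis
    by (induction f rule: free_alg_induct) (auto simp: nf_add nf_scale mono triangular_add triangular_scale)
qed

text \<open>The sign \<open>d\<close> is 1 for the ladder of \<open>X\<close> and -1 for that of
  \<open>Y\<close>. The representative lives strictly on that side of degree zero.\<close>

lemma ladder_degree:
  assumes "f \<in> ladder (\<lambda>i. nf (gen (c i)))" "\<And>i. gen_degree (c i) = d" "d * d = 1"
  shows "\<exists>f'. f = nf f' \<and> (\<forall>r. d * r \<le> 0 \<longrightarrow> degree_comp r f' = 0)"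
  using assms(1)
proof induction
  case (base i)
  show ?case
    using assms(2,3) by (intro exI[of _ "gen (c i)"]) (auto simp: gen_def restr_single)
next
  case (step f i)
  then obtain f' where f': "f = nf f'" "\<forall>r. d * r \<le> 0 \<longrightarrow> degree_comp r f' = 0" by blast
  have "degree_comp r (br (gen (c i)) f') = 0" if "d * r \<le> 0" for r
  proof -
    have "d * (r - d) \<le> 0" using that assms(3) by (simp add: algebra_simps)
    then show ?thesis using f'(2) degree_comp_br_left[of "gen (c i)" d r f'] assms(2) by simp
  qed
  then show ?case using f'(1) by (intro exI[of _ "br (gen (c i)) f'"]) auto
next
  case (add f g)
  then obtain f' g' where "f = nf f'" "\<forall>r. d * r \<le> 0 \<longrightarrow> degree_comp r f' = 0"
    "g = nf g'" "\<forall>r. d * r \<le> 0 \<longrightarrow> degree_comp r g' = 0" by blast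
  then show ?case by (intro exI[of _ "f' + g'"]) (auto simp: nf_add restr_add)
next
  case (scale f k)
  then obtain f' where "f = nf f'" "\<forall>r. d * r \<le> 0 \<longrightarrow> degree_comp r f' = 0" by blast
  then show ?case by (intro exI[of _ "fscale k f'"]) (auto simp: nf_scale restr_fscale)
qed

text \<open>In a triangular decomposition of \<open>f\<close>, passing to degree zero leaves only
  the Cartan term. The congruence modulo \<open>J\<close> survives this because \<open>J\<close> is
  graded.\<close>

lemma degree_zero_cartan:
  assumes "f \<in> degree_part 0"
  shows "\<exists>h. f - gen (Cartan h) \<in> J"
proof -
  obtain g h k where *: "g \<in> ladder (\<lambda>i. nf (gen (Y i)))" "k \<in> ladder (\<lambda>i. nf (gen (X i)))"
    "nf f = g + nf (gen (Cartan h)) + k"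
    using nf_triangular[of f] unfolding triangular_def by blast
  obtain g' where g': "g = nf g'" "degree_comp 0 g' = 0"
    using ladder_degree[OF *(1), of "-1"] by auto
  obtain k' where k': "k = nf k'" "degree_comp 0 k' = 0"
    using ladder_degree[OF *(2), of 1] by auto
  have "f - (g' + gen (Cartan h) + k') \<in> J"
    using *(3) by (simp add: nf_eq[symmetric] nf_add g' k')
  from degree_comp_mem[OF this, of 0] have "f - gen (Cartan h) \<in> J"
    using assms by (simp add: restr_diff restr_add g' k' degree_comp_other gen_def restr_single)
  then show ?thesis by blast
qed

end

section \<open>The greatest ideal meeting the Cartan space trivially\<close>

text \<open>If the joint image of the \<open>\<alpha> i\<close> were a proper subspace, a nonzero
  functional vanishing on it would be a linear relation among them. Constant \<open>c = 1\<close>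
  yields the grading element.\<close>

lemma realization_dual_point:
  fixes A :: "'k::field^'n^'n"
  assumes "realization sc A hv \<alpha>"
  shows "\<exists>x. \<forall>i. \<alpha> i x = c i"
proof -
  have lin: "Vector_Spaces.linear sc (*) (\<alpha> i)" for i
    using assms unfolding realization_def by (elim conjE) (rule spec)
  have indep: "\<forall>u. (\<forall>x. (\<Sum>i\<in>UNIV. u i * \<alpha> i x) = 0) \<longrightarrow> (\<forall>i. u i = 0)"
    using assms unfolding realization_def by (elim conjE)
  have add: "\<alpha> i (x + y) = \<alpha> i x + \<alpha> i y" and scale: "\<alpha> i (sc k x) = k * \<alpha> i x" for i x y k
    using lin[of i] by (auto simp: Vector_Spaces.linear_iff)
  define V where "V = range (\<lambda>x. \<chi> i. \<alpha> i x)"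
  have V: "vec.subspace V"
    unfolding vec.subspace_def
  proof (intro conjI ballI allI)
    show "0 \<in> V" unfolding V_def
      using scale[of _ 0 undefined] by (intro image_eqI[of _ _ "sc 0 undefined"]) (auto simp: vec_eq_iff)
    show "u + v \<in> V" if uv: "u \<in> V" "v \<in> V" for u v
    proof -
      obtain x y where "u = (\<chi> i. \<alpha> i x)" "v = (\<chi> i. \<alpha> i y)" using uv unfolding V_def by blast
      then show ?thesis unfolding V_def by (intro image_eqI[of _ _ "x + y"]) (auto simp: vec_eq_iff add)
    qed
    show "k *s u \<in> V" if uv: "u \<in> V" for k u
    proof -
      obtain x where "u = (\<chi> i. \<alpha> i x)" using uv unfolding V_def by blast
      then show ?thesis unfolding V_def by (intro image_eqI[of _ _ "sc k x"]) (auto simp: vec_eq_iff scale)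
    qed
  qed
  have "V = UNIV"
  proof (rule ccontr)
    assume "V \<noteq> UNIV"
    then obtain b where b: "b \<notin> V" by blast
    obtain B where B: "B \<subseteq> V" "vec.independent B" "V \<subseteq> vec.span B"
      using vec.basis_exists[of V] by metis
    have span: "vec.span B = V" using B V vec.span_minimal by blast
    have bB: "vec.independent (insert b B)" using B(2) b span by (simp add: vec.independent_insert)
    interpret vp: vector_space_pair "(*s) :: 'k \<Rightarrow> 'k^'n \<Rightarrow> 'k^'n" "(*) :: 'k \<Rightarrow> 'k \<Rightarrow> 'k"
      by unfold_locales (auto simp: algebra_simps)
    \<comment> \<open>This functional vanishes on \<open>V\<close> and is 1 at \<open>b\<close>; its
      values on the unit vectors are the coefficients of the forbidden relation.\<close>
    obtain g where g: "Vector_Spaces.linear (*s) (*) g" "\<forall>v\<in>insert b B. g v = (if v = b then 1 else 0)"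
      using vp.linear_independent_extend[OF bB, of "\<lambda>v. if v = b then 1 else 0"] by blast
    interpret g: Vector_Spaces.linear "(*s)" "(*)" g by (rule g(1))
    have gV: "g v = 0" if "v \<in> V" for v
    proof -
      have "v \<in> vec.span B" using that span by simp
      then show ?thesis
        by (induction rule: vec.span_induct_alt) (use g(2) b B(1) in \<open>auto simp: g.add g.scale\<close>)
    qed
    have expand: "g v = (\<Sum>i\<in>UNIV. g (axis i 1) * v $ i)" for v
    proof -
      have "v = (\<Sum>i\<in>UNIV. v $ i *s axis i 1)" by (simp add: basis_expansion)
      then have "g v = g (\<Sum>i\<in>UNIV. v $ i *s axis i 1)" by simp
      also have "\<dots> = (\<Sum>i\<in>UNIV. g (axis i 1) * v $ i)"
        by (simp add: g.sum g.scale mult.commute)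
      finally show ?thesis .
    qed
    have "\<forall>x. (\<Sum>i\<in>UNIV. g (axis i 1) * \<alpha> i x) = 0"
      using gV expand unfolding V_def by (metis (no_types, lifting) rangeI sum.cong vec_lambda_beta)
    then have "\<forall>i. g (axis i 1) = 0" using indep[rule_format, of "\<lambda>i. g (axis i 1)"] by blast
    then have "g b = 0" using expand[of b] by simp
    then show False using g(2) by simp
  qed
  then have "(\<chi> i. c i) \<in> V" by simp
  then show ?thesis unfolding V_def by (auto simp: vec_eq_iff)
qed

text \<open>The candidate is the sum \<open>U\<close> of all admissible ideals. Admissibility is
  passed to sums in the form that all degree zero components lie in \<open>R\<close>: such a
  component is a Cartan generator modulo \<open>R\<close>, and it stays in the ideal by
  gradedness.\<close>

lemma contragredient_ideal_greatest:
  fixes sc :: "'k::field_char_0 \<Rightarrow> 'h::ab_group_add \<Rightarrow> 'h" and hv :: "'n \<Rightarrow> 'h"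
    and \<alpha> :: "'n \<Rightarrow> 'h \<Rightarrow> 'k" and p :: "'n \<Rightarrow> bit"
  assumes x0: "\<And>i. \<alpha> i x0 = 1"
  defines "R \<equiv> relation_ideal sc hv \<alpha> p"
  defines "I \<equiv> contragredient_ideal sc hv \<alpha> p"
  shows "super_ideal p I \<and> R \<subseteq> I \<and> (\<forall>x. gen (Cartan x) \<in> I \<longrightarrow> gen (Cartan x) \<in> R)"
proof -
  define P where "P J \<longleftrightarrow> super_ideal p J \<and> R \<subseteq> J \<and> (\<forall>x. gen (Cartan x) \<in> J \<longrightarrow> gen (Cartan x) \<in> R)" for J
  have R: "super_ideal p R" unfolding R_def by (rule relation_ideal_super)
  obtain nf where nf: "\<And>f g. nf (f + g) = nf f + nf g" "\<And>c f. nf (fscale c f) = fscale c (nf f)"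
    "\<And>f. nf (nf f) = nf f" "\<And>f. nf f = 0 \<longleftrightarrow> f \<in> R"
    using exists_quotient_projection[OF super_ideal_subspace[OF R]] by metis
  interpret r: graded_quotient_projection sc hv \<alpha> p R nf x0
    by unfold_locales (use R nf x0 in \<open>auto simp: R_def intro: subsetD[OF relators_subset]\<close>)
  have comp_R: "degree_comp 0 f \<in> R" if J: "P J" and f: "f \<in> J" for J f
  proof -
    have J': "super_ideal p J" "R \<subseteq> J" "\<And>x. gen (Cartan x) \<in> J \<Longrightarrow> gen (Cartan x) \<in> R"
      using J by (auto simp: P_def)
    obtain nf' where nf': "\<And>f g. nf' (f + g) = nf' f + nf' g" "\<And>c f. nf' (fscale c f) = fscale c (nf' f)"
      "\<And>f. nf' (nf' f) = nf' f" "\<And>f. nf' f = 0 \<longleftrightarrow> f \<in> J"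
      using exists_quotient_projection[OF super_ideal_subspace[OF J'(1)]] by metis
    interpret j: graded_quotient_projection sc hv \<alpha> p J nf' x0
      by unfold_locales (use J' nf' x0 in \<open>auto simp: R_def intro: subsetD[OF relators_subset]\<close>)
    obtain h where h: "degree_comp 0 f - gen (Cartan h) \<in> R"
      using r.degree_zero_cartan[OF degree_comp_part] by blast
    have "degree_comp 0 f \<in> J" by (rule j.degree_comp_mem[OF f])
    then have "degree_comp 0 f - (degree_comp 0 f - gen (Cartan h)) \<in> J"
      using h J'(2) free.subspace_diff[OF super_ideal_subspace[OF J'(1)]] by blast
    then have "gen (Cartan h) \<in> R" using J'(3) by simp
    then have "(degree_comp 0 f - gen (Cartan h)) + gen (Cartan h) \<in> R"
      using h free.subspace_add[OF super_ideal_subspace[OF R]] by blast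
    then show ?thesis by simp
  qed
  define U where "U = free.span (\<Union>{J. P J})"
  have "P R" using R by (simp add: P_def)
  have comp_U: "degree_comp 0 f \<in> R" if "f \<in> U" for f
    using that unfolding U_def
  proof (induction rule: free.span_induct_alt)
    case base
    show ?case using free.subspace_0[OF super_ideal_subspace[OF R]] by simp
  next
    case (step c f g)
    then have "degree_comp 0 f \<in> R" using comp_R by blast
    then show ?case
      using step(2) free.subspace_add[OF super_ideal_subspace[OF R]] free.subspace_scale[OF super_ideal_subspace[OF R]]
      by (simp add: restr_add restr_fscale)
  qed
  have "gen (Cartan x) \<in> R" if "gen (Cartan x) \<in> U" for x
    using comp_U[OF that] by (simp add: gen_def restr_single)
  moreover have "super_ideal p U" unfolding U_def
    by (rule super_ideal_span_Union) (auto simp: P_def)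
  moreover have "J \<subseteq> U" if "P J" for J
    using order.trans[OF Union_upper[of J "{J. P J}"] free.span_superset] that by (simp add: U_def)
  ultimately have "P U" "\<And>J. P J \<Longrightarrow> J \<subseteq> U" using \<open>P R\<close> by (auto simp: P_def)
  then have "(GREATEST J. P J) = U" by (rule Greatest_equality)
  then have "I = U" by (simp add: I_def contragredient_ideal_def P_def R_def)
  with \<open>P U\<close> show ?thesis by (simp add: P_def)
qed

section \<open>A Verma-type representation\<close>

locale word_representation =
  fixes sc :: "'k::field \<Rightarrow> 'h::ab_group_add \<Rightarrow> 'h" and hv :: "'n \<Rightarrow> 'h" and \<alpha> :: "'n \<Rightarrow> 'h \<Rightarrow> 'k"
    and p :: "'n \<Rightarrow> bit"
  assumes \<alpha>_add: "\<alpha> i (x + y) = \<alpha> i x + \<alpha> i y" and \<alpha>_scale: "\<alpha> i (sc c x) = c * \<alpha> i x"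
begin

definition weight :: "'h \<Rightarrow> 'n list \<Rightarrow> 'k" where
  "weight h w = (\<Sum>j\<leftarrow>w. \<alpha> j h)"

lemma weight_simps [simp]: "weight h [] = 0" "weight h (j # w) = \<alpha> j h + weight h w"
  by (simp_all add: weight_def)

lemma weight_add: "weight (x + y) w = weight x w + weight y w"
  by (induction w) (auto simp: \<alpha>_add)

lemma weight_scale: "weight (sc c x) w = c * weight x w"
  by (induction w) (auto simp: \<alpha>_scale algebra_simps)

text \<open>Functions on words form the dual of a Verma module, so that \<open>Y i\<close> deletes a letter. The
  recursion is forced by the relation between \<open>X i\<close> and \<open>Y j\<close>.\<close>

primrec x_op :: "'n \<Rightarrow> 'n list \<Rightarrow> ('n list \<Rightarrow> 'k) \<Rightarrow> 'k" where
  "x_op i [] \<phi> = 0"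
| "x_op i (j # w) \<phi> = super_sign (p i) (p j) *
     (x_op i w (\<lambda>v. \<phi> (j # v)) - (if i = j then weight (hv i) w * \<phi> w else 0))"

section \<open>The action of the free superalgebra on functions on words\<close>

primrec gen_op :: "('h, 'n) generator \<Rightarrow> ('n list \<Rightarrow> 'k) \<Rightarrow> 'n list \<Rightarrow> 'k" where
  "gen_op (Cartan h) \<phi> = (\<lambda>w. weight h w * \<phi> w)"
| "gen_op (X i) \<phi> = (\<lambda>w. x_op i w \<phi>)"
| "gen_op (Y i) \<phi> = (\<lambda>w. \<phi> (i # w))"

primrec mono_op :: "('h, 'n) generator monomial \<Rightarrow> ('n list \<Rightarrow> 'k) \<Rightarrow> 'n list \<Rightarrow> 'k" where
  "mono_op (Gen g) \<phi> = gen_op g \<phi>"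
| "mono_op (Prod s t) \<phi> = (\<lambda>w. mono_op s (mono_op t \<phi>) w -
     super_sign (monomial_parity p s) (monomial_parity p t) * mono_op t (mono_op s \<phi>) w)"

definition alg_op :: "('h, 'n, 'k) free_alg \<Rightarrow> ('n list \<Rightarrow> 'k) \<Rightarrow> 'n list \<Rightarrow> 'k" where
  "alg_op f \<phi> w = (\<Sum>s\<in>Poly_Mapping.keys f. Poly_Mapping.lookup f s * mono_op s \<phi> w)"

lemma x_op_lin: "x_op i w (\<lambda>v. a * \<phi> v + b * \<psi> v) = a * x_op i w \<phi> + b * x_op i w \<psi>"
proof (induction w arbitrary: \<phi> \<psi>)
  case (Cons j w)
  show ?case
    using Cons[of "\<lambda>v. \<phi> (j # v)" "\<lambda>v. \<psi> (j # v)"] by (simp add: algebra_simps)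
qed simp

lemma mono_op_lin: "mono_op s (\<lambda>v. a * \<phi> v + b * \<psi> v) = (\<lambda>w. a * mono_op s \<phi> w + b * mono_op s \<psi> w)"
proof (induction s arbitrary: \<phi> \<psi> a b)
  case (Gen g)
  show ?case by (cases g) (auto simp: x_op_lin algebra_simps)
next
  case (Prod s t)
  show ?case by (rule ext) (simp add: Prod algebra_simps)
qed

lemma mono_op_zero [simp]: "mono_op s (\<lambda>v. 0) = (\<lambda>w. 0)"
  using mono_op_lin[of s 0 "\<lambda>_. 0" 0 "\<lambda>_. 0"] by simp

lemma alg_op_lin: "alg_op f (\<lambda>v. a * \<phi> v + b * \<psi> v) = (\<lambda>w. a * alg_op f \<phi> w + b * alg_op f \<psi> w)"
  by (rule ext) (simp add: alg_op_def mono_op_lin sum.distrib sum_distrib_left algebra_simps)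

lemma alg_op_minus_scale: "alg_op f (\<lambda>v. \<phi> v - b * \<psi> v) = (\<lambda>w. alg_op f \<phi> w - b * alg_op f \<psi> w)"
  using alg_op_lin[of f 1 \<phi> "- b" \<psi>] by simp

lemma alg_op_zero_arg [simp]: "alg_op f (\<lambda>v. 0) = (\<lambda>w. 0)"
  using alg_op_lin[of f 0 "\<lambda>_. 0" 0 "\<lambda>_. 0"] by simp

lemma alg_op_superset:
  "finite S \<Longrightarrow> Poly_Mapping.keys f \<subseteq> S \<Longrightarrow>
    alg_op f \<phi> w = (\<Sum>s\<in>S. Poly_Mapping.lookup f s * mono_op s \<phi> w)"
  unfolding alg_op_def by (intro sum.mono_neutral_left) (auto simp: in_keys_iff)

lemma alg_op_add: "alg_op (f + g) \<phi> = (\<lambda>w. alg_op f \<phi> w + alg_op g \<phi> w)"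
proof
  fix w
  let ?S = "Poly_Mapping.keys f \<union> Poly_Mapping.keys g"
  have S: "finite ?S" "Poly_Mapping.keys f \<subseteq> ?S" "Poly_Mapping.keys g \<subseteq> ?S" "Poly_Mapping.keys (f + g) \<subseteq> ?S"
    using Poly_Mapping.keys_add[of f g] by auto
  show "alg_op (f + g) \<phi> w = alg_op f \<phi> w + alg_op g \<phi> w"
    by (simp add: alg_op_superset[OF S(1,2)] alg_op_superset[OF S(1,3)] alg_op_superset[OF S(1,4)]
        lookup_add algebra_simps sum.distrib)
qed

lemma alg_op_scale: "alg_op (fscale c f) \<phi> = (\<lambda>w. c * alg_op f \<phi> w)"
proof
  fix w
  have "Poly_Mapping.keys (fscale c f) \<subseteq> Poly_Mapping.keys f"
    by (auto simp: in_keys_iff)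
  then show "alg_op (fscale c f) \<phi> w = c * alg_op f \<phi> w"
    by (subst alg_op_superset[of "Poly_Mapping.keys f"]) (auto simp: alg_op_def sum_distrib_left algebra_simps)
qed

lemma alg_op_zero [simp]: "alg_op 0 \<phi> = (\<lambda>w. 0)"
  by (rule ext) (simp add: alg_op_def)

lemma alg_op_diff: "alg_op (f - g) \<phi> = (\<lambda>w. alg_op f \<phi> w - alg_op g \<phi> w)"
  using alg_op_add[of "f - g" g \<phi>] by (auto simp: fun_eq_iff)

lemma alg_op_single [simp]: "alg_op (Poly_Mapping.single s 1) \<phi> = mono_op s \<phi>"
  by (rule ext) (simp add: alg_op_def)

lemma alg_op_gen [simp]: "alg_op (gen g) \<phi> = gen_op g \<phi>"
  unfolding gen_def by simp

text \<open>On monomials this is the definition of \<open>mono_op\<close>. The induction runs over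
  the parity components of arbitrary elements, since a homogeneous element cannot be assumed in the
  hypothesis of \<open>free_alg_induct\<close>.\<close>

lemma alg_op_br:
  assumes "f \<in> parity_part p \<epsilon>" "g \<in> parity_part p \<delta>"
  shows "alg_op (br f g) \<phi> = (\<lambda>w. alg_op f (alg_op g \<phi>) w - super_sign \<epsilon> \<delta> * alg_op g (alg_op f \<phi>) w)"
proof -
  let ?P = "\<lambda>f g. alg_op (br (parity_comp p \<epsilon> f) (parity_comp p \<delta> g)) \<phi> =
    (\<lambda>w. alg_op (parity_comp p \<epsilon> f) (alg_op (parity_comp p \<delta> g) \<phi>) w -
      super_sign \<epsilon> \<delta> * alg_op (parity_comp p \<delta> g) (alg_op (parity_comp p \<epsilon> f) \<phi>) w)"
  have add_arg: "alg_op f (\<lambda>v. \<phi> v + \<psi> v) = (\<lambda>w. alg_op f \<phi> w + alg_op f \<psi> w)" for f \<phi> \<psi>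
    using alg_op_lin[of f 1 \<phi> 1 \<psi>] by simp
  have scale_arg: "alg_op f (\<lambda>v. c * \<phi> v) = (\<lambda>w. c * alg_op f \<phi> w)" for f \<phi> c
    using alg_op_lin[of f c \<phi> 0 \<phi>] by simp
  have mono: "?P (Poly_Mapping.single s 1) (Poly_Mapping.single t 1)" for s t
    by (auto simp: restr_single br_single)
  have "?P (Poly_Mapping.single s 1) g" for s
    by (induction g rule: free_alg_induct)
       (simp_all add: mono restr_add restr_fscale br_add_right br_fscale_right alg_op_add alg_op_scale
          add_arg scale_arg algebra_simps del: alg_op_single)
  then have "?P f g"
    by (induction f rule: free_alg_induct)
       (simp_all add: restr_add restr_fscale br_add_left br_fscale_left alg_op_add alg_op_scale
          add_arg scale_arg algebra_simps del: alg_op_single)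
  then show ?thesis using assms by (simp add: parity_part_iff)
qed

text \<open>Vanishing is demanded of both parity components, so that closure under the projections
  is immediate.\<close>

definition kernel :: "('h, 'n, 'k) free_alg set" where
  "kernel = {f. \<forall>\<epsilon> \<phi>. alg_op (parity_comp p \<epsilon> f) \<phi> = (\<lambda>w. 0)}"

lemma kernelI: "f \<in> parity_part p \<epsilon> \<Longrightarrow> (\<And>\<phi> w. alg_op f \<phi> w = 0) \<Longrightarrow> f \<in> kernel"
  by (auto simp: kernel_def parity_comp_other)

lemma kernel_super_ideal: "super_ideal p kernel"
proof -
  have "br f g \<in> kernel" "br g f \<in> kernel" if "f \<in> kernel" for f g
    using that unfolding kernel_def
    by (simp_all add: parity_comp_br alg_op_add alg_op_br[OF parity_comp_part parity_comp_part])
  moreover have "parity_comp p \<epsilon> f \<in> kernel" if "f \<in> kernel" for f \<epsilon>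
    using that by (simp add: kernel_def parity_comp_comp)
  moreover have "free.subspace kernel"
    by (auto simp: free_subspace_alt kernel_def restr_add restr_fscale alg_op_add alg_op_scale)
  ultimately show ?thesis by (simp add: super_ideal_alt)
qed

section \<open>The relators act by zero\<close>

lemma x_op_weight: "x_op i w (\<lambda>v. weight h v * \<phi> v) = (weight h w - \<alpha> i h) * x_op i w \<phi>"
proof (induction w arbitrary: \<phi>)
  case (Cons j w)
  have "x_op i w (\<lambda>v. (\<alpha> j h + weight h v) * \<phi> (j # v)) =
    \<alpha> j h * x_op i w (\<lambda>v. \<phi> (j # v)) + x_op i w (\<lambda>v. weight h v * \<phi> (j # v))"
    using x_op_lin[of i w "\<alpha> j h" "\<lambda>v. \<phi> (j # v)" 1 "\<lambda>v. weight h v * \<phi> (j # v)"]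
    by (simp add: algebra_simps)
  then show ?case by (simp only: x_op.simps weight_simps Cons) (simp add: algebra_simps)
qed simp

lemma super_sign_sq: "super_sign \<epsilon> \<delta> * (super_sign \<epsilon> \<delta> * z) = (z :: 'k)"
  by (simp add: super_sign_def)

text \<open>Supercommutators of operators satisfy the super Jacobi identity. Homogeneity of
  \<open>k\<close> lets every bracket be expanded by \<open>alg_op_br\<close>; a general
  \<open>k\<close> is later split into its two components.\<close>

lemma jacobi_kernel:
  assumes "f \<in> parity_part p \<epsilon>" "g \<in> parity_part p \<delta>" "k \<in> parity_part p \<theta>"
  shows "br f (br g k) - br (br f g) k - fscale (super_sign \<epsilon> \<delta>) (br g (br f k)) \<in> kernel"
proof (rule kernelI)
  note par = assms br_parity_part[OF assms(1,2)] br_parity_part[OF assms(1,3)] br_parity_part[OF assms(2,3)]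
  have eq: "\<epsilon> + \<delta> + \<theta> = \<epsilon> + (\<delta> + \<theta>)" "\<epsilon> + (\<delta> + \<theta>) = \<delta> + (\<epsilon> + \<theta>)"
    by (rule add.assoc, rule add.left_commute)
  have "br f (br g k) \<in> parity_part p (\<epsilon> + (\<delta> + \<theta>))" "br (br f g) k \<in> parity_part p (\<epsilon> + (\<delta> + \<theta>))"
    "br g (br f k) \<in> parity_part p (\<epsilon> + (\<delta> + \<theta>))"
    using br_parity_part[OF par(1,6)] br_parity_part[OF par(4,3)] br_parity_part[OF par(2,5)]
    by (simp_all only: eq)
  then show "br f (br g k) - br (br f g) k - fscale (super_sign \<epsilon> \<delta>) (br g (br f k)) \<in> parity_part p (\<epsilon> + (\<delta> + \<theta>))"
    by (intro free.subspace_diff[OF subspace_parity_part] free.subspace_scale[OF subspace_parity_part])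
  fix \<phi> w
  show "alg_op (br f (br g k) - br (br f g) k - fscale (super_sign \<epsilon> \<delta>) (br g (br f k))) \<phi> w = 0"
    unfolding alg_op_diff alg_op_scale alg_op_br[OF par(1,6)] alg_op_br[OF par(4,3)] alg_op_br[OF par(2,5)]
      alg_op_br[OF par(1,2)] alg_op_br[OF par(1,3)] alg_op_br[OF par(2,3)] alg_op_minus_scale
    by (cases \<epsilon>; cases \<delta>; cases \<theta>) (simp_all add: super_sign_def algebra_simps)
qed

lemma relators_kernel: "relators sc hv \<alpha> p \<subseteq> kernel"
proof -
  note sub = super_ideal_subspace[OF kernel_super_ideal]
  have g: "gen g \<in> parity_part p (gen_parity p g)" for g :: "('h, 'n) generator"
    by simp
  have "br f (br g k) - br (br f g) k - fscale (super_sign \<epsilon> \<delta>) (br g (br f k)) \<in> kernel"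
    if fg: "f \<in> parity_part p \<epsilon>" "g \<in> parity_part p \<delta>" for f g k \<epsilon> \<delta>
  proof -
    let ?r = "\<lambda>k. br f (br g k) - br (br f g) k - fscale (super_sign \<epsilon> \<delta>) (br g (br f k))"
    have "?r (parity_comp p 0 k) + ?r (parity_comp p 1 k) \<in> kernel"
      by (intro free.subspace_add[OF sub] jacobi_kernel[OF fg parity_comp_part[of p 0 k]]
          jacobi_kernel[OF fg parity_comp_part[of p 1 k]])
    also have "?r (parity_comp p 0 k) + ?r (parity_comp p 1 k) = ?r (parity_comp p 0 k + parity_comp p 1 k)"
      by (simp add: br_add_right free.scale_right_distrib)
    finally show ?thesis using parity_decomp[of k p] by simp
  qed
  moreover have "br f g + fscale (super_sign \<epsilon> \<delta>) (br g f) \<in> kernel"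
    if fg: "f \<in> parity_part p \<epsilon>" "g \<in> parity_part p \<delta>" for f g \<epsilon> \<delta>
  proof (rule kernelI)
    have "br f g \<in> parity_part p (\<epsilon> + \<delta>)" "br g f \<in> parity_part p (\<epsilon> + \<delta>)"
      using br_parity_part[OF fg] br_parity_part[OF fg(2,1)] by (simp_all only: add.commute[of \<delta> \<epsilon>])
    then show "br f g + fscale (super_sign \<epsilon> \<delta>) (br g f) \<in> parity_part p (\<epsilon> + \<delta>)"
      by (intro free.subspace_add[OF subspace_parity_part] free.subspace_scale[OF subspace_parity_part])
    show "alg_op (br f g + fscale (super_sign \<epsilon> \<delta>) (br g f)) \<phi> w = 0" for \<phi> w
      unfolding alg_op_add alg_op_scale alg_op_br[OF fg] alg_op_br[OF fg(2,1)]
      by (cases \<epsilon>; cases \<delta>) (simp_all add: super_sign_def)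
  qed
  moreover have "gen (Cartan (x + y)) - gen (Cartan x) - gen (Cartan y) \<in> kernel" for x y
    by (rule kernelI[of _ 0])
       (auto intro!: free.subspace_diff[OF subspace_parity_part] simp: alg_op_diff weight_add ring_distribs)
  moreover have "gen (Cartan (sc c x)) - fscale c (gen (Cartan x)) \<in> kernel" for c x
    by (rule kernelI[of _ 0])
       (auto intro!: free.subspace_diff[OF subspace_parity_part] free.subspace_scale[OF subspace_parity_part]
         simp: alg_op_diff alg_op_scale weight_scale algebra_simps)
  moreover have "br (gen (Cartan x)) (gen (Cartan y)) \<in> kernel" for x y
    using br_parity_part[OF g g, of "Cartan x" "Cartan y"]
    by (intro kernelI[of _ 0]) (auto simp: alg_op_br[OF g g] super_sign_def)
  moreover have "br (gen (Cartan x)) (gen (X i)) - fscale (\<alpha> i x) (gen (X i)) \<in> kernel" for x i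
    using br_parity_part[OF g g, of "Cartan x" "X i", unfolded gen_parity.simps add_0_left]
    by (intro kernelI[of _ "p i"])
      (auto intro!: free.subspace_diff[OF subspace_parity_part] free.subspace_scale[OF subspace_parity_part]
        simp: alg_op_diff alg_op_scale alg_op_br[OF g g] super_sign_def x_op_weight ring_distribs)
  moreover have "br (gen (Cartan x)) (gen (Y i)) + fscale (\<alpha> i x) (gen (Y i)) \<in> kernel" for x i
    using br_parity_part[OF g g, of "Cartan x" "Y i", unfolded gen_parity.simps add_0_left]
    by (intro kernelI[of _ "p i"])
      (auto intro!: free.subspace_add[OF subspace_parity_part] free.subspace_scale[OF subspace_parity_part]
        simp: alg_op_add alg_op_scale alg_op_br[OF g g] super_sign_def ring_distribs)
  moreover have "br (gen (X i)) (gen (Y j)) - (if i = j then gen (Cartan (hv i)) else 0) \<in> kernel" for i j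
  proof (rule kernelI[of _ "p i + p j"])
    have "(if i = j then gen (Cartan (hv i)) else 0) \<in> parity_part p (p i + p j)"
      using free.subspace_0[OF subspace_parity_part] by (cases "p i") auto
    then show "br (gen (X i)) (gen (Y j)) - (if i = j then gen (Cartan (hv i)) else 0) \<in> parity_part p (p i + p j)"
      using br_parity_part[OF g g, of "X i" "Y j"] by (intro free.subspace_diff[OF subspace_parity_part]) auto
    show "alg_op (br (gen (X i)) (gen (Y j)) - (if i = j then gen (Cartan (hv i)) else 0)) \<phi> w = 0" for \<phi> w
      by (auto simp: alg_op_diff alg_op_br[OF g g] super_sign_sq)
  qed
  ultimately show ?thesis
    unfolding relators_def Un_subset_iff by (intro conjI subsetI; elim CollectE exE conjE; hypsubst)
qed

text \<open>Serves to show that the Cartan elements \<open>[u n, w n]\<close> survive in the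
  quotient.\<close>

lemma relation_ideal_Cartan:
  assumes "gen (Cartan h) \<in> relation_ideal sc hv \<alpha> p"
  shows "\<alpha> i h = 0"
proof -
  have "gen (Cartan h) \<in> kernel"
    using relation_ideal_minimal[OF kernel_super_ideal relators_kernel] assms by blast
  \<comment> \<open>At the one-letter word \<open>[i]\<close>, \<open>Cartan h\<close> multiplies
    the constant function 1 by \<open>\<alpha> i h\<close>.\<close>
  then have "alg_op (parity_comp p 0 (gen (Cartan h))) (\<lambda>_. 1) [i] = 0" by (simp add: kernel_def)
  moreover have "parity_comp p 0 (gen (Cartan h) :: ('h, 'n, 'k) free_alg) = gen (Cartan h)" by (simp add: parity_comp_other)
  ultimately show ?thesis by simp
qed

end

section \<open>Dual families of odd elements\<close>

text \<open>\<open>E\<close>, \<open>F\<close>, \<open>\<kappa>\<close> form an sl2-triple for which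
  \<open>w0\<close> is a lowest weight vector of weight \<open>q\<close>; \<open>\<epsilon>\<close>
  and \<open>\<xi>\<close> are the weights of \<open>E\<close> and \<open>w0\<close> as functionals
  on the Cartan space. By \<open>q_nonzero\<close> the string above \<open>w0\<close> never
  ends.\<close>

locale sl2_string = contragredient_algebra scl bra par sc hv \<alpha> p cart x y
  for scl :: "'k::field_char_0 \<Rightarrow> 'v::ab_group_add \<Rightarrow> 'v" and bra par
    and sc :: "'k \<Rightarrow> 'h::ab_group_add \<Rightarrow> 'h" and hv :: "'n \<Rightarrow> 'h" and \<alpha> p cart x y +
  fixes E F w0 u0 :: 'v and \<kappa> \<eta> :: 'h and \<epsilon> \<xi> :: "'h \<Rightarrow> 'k" and q r :: 'k
  assumes EF_even: "E \<in> par 0" "F \<in> par 0" and wu_odd: "w0 \<in> par 1" "u0 \<in> par 1"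
    and EF: "bra E F = cart \<kappa>" and u0_w0: "bra u0 w0 = cart \<eta>"
    and F_w0: "bra F w0 = 0" and E_u0: "bra E u0 = 0"
    and cart_E: "bra (cart h) E = scl (\<epsilon> h) E" and cart_w0: "bra (cart h) w0 = scl (\<xi> h) w0"
    and cart_F: "bra (cart h) F = scl (- \<epsilon> h) F"
    and \<epsilon>_add: "\<epsilon> (h + h') = \<epsilon> h + \<epsilon> h'" and \<epsilon>_scale: "\<epsilon> (sc c h) = c * \<epsilon> h"
    and \<xi>_add: "\<xi> (h + h') = \<xi> h + \<xi> h'" and \<xi>_scale: "\<xi> (sc c h) = c * \<xi> h"
    and \<epsilon>_\<kappa>: "\<epsilon> \<kappa> = 2" and \<xi>_\<kappa>: "\<xi> \<kappa> = q" and \<epsilon>_\<eta>: "\<epsilon> \<eta> = r" and \<xi>_\<eta>: "\<xi> \<eta> = 0"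
    and q_nonzero: "q + of_nat n \<noteq> 0"
begin

section \<open>The two strings and their brackets\<close>

definition w :: "nat \<Rightarrow> 'v" where "w n = (bra E ^^ n) w0"
definition u :: "nat \<Rightarrow> 'v" where "u n = (bra F ^^ n) u0"
text \<open>The usual sl2 coefficient: \<open>F\<close> takes \<open>w n\<close> to
  \<open>- d n\<close> times \<open>w (n - 1)\<close>.\<close>

definition d :: "nat \<Rightarrow> 'k" where "d n = of_nat n * (q + of_nat n - 1)"
definition D :: "nat \<Rightarrow> 'k" where "D n = (\<Prod>i<n. d (Suc i))"
definition \<omega> :: "nat \<Rightarrow> 'h \<Rightarrow> 'k" where "\<omega> n h = \<xi> h + of_nat n * \<epsilon> h"

text \<open>The Cartan element \<open>[u n, w n]\<close>. The recursion comes from moving one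
  \<open>F\<close> out of \<open>u (Suc n)\<close>; the term in \<open>\<kappa>\<close> arises from
  \<open>[F, E]\<close>.\<close>

primrec g :: "nat \<Rightarrow> 'h" where
  "g 0 = \<eta>"
| "g (Suc n) = sc (d (Suc n)) (g n) + sc (r / q * D (Suc n)) \<kappa>"

lemma w_simps [simp]: "w 0 = w0" "w (Suc n) = bra E (w n)" and u_simps [simp]: "u 0 = u0" "u (Suc n) = bra F (u n)"
  by (simp_all add: w_def u_def)

lemma D_simps: "D 0 = 1" "D (Suc n) = d (Suc n) * D n"
  by (simp_all add: D_def)

lemma D_nonzero: "D n \<noteq> 0"
proof -
  have "d (Suc i) \<noteq> 0" for i
    using q_nonzero[of i] of_nat_neq_0[of i, where 'a = 'k] by (simp add: d_def)
  then show ?thesis by (simp add: D_def)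
qed

lemma w_odd: "w n \<in> par 1"
  by (induction n) (use par_bra[OF EF_even(1), of _ 1] wu_odd in auto)

lemma u_odd: "u n \<in> par 1"
  by (induction n) (use par_bra[OF EF_even(2), of _ 1] wu_odd in auto)

lemma cart_w: "bra (cart h) (w n) = scl (\<omega> n h) (w n)"
proof (induction n)
  case 0
  show ?case by (simp add: cart_w0 \<omega>_def)
next
  case (Suc n)
  have "bra (cart h) (w (Suc n)) = bra (bra (cart h) E) (w n) + bra E (bra (cart h) (w n))"
    using jacobi_even[OF cart_even EF_even(1)] by simp
  also have "\<dots> = scl (\<epsilon> h + \<omega> n h) (w (Suc n))"
    by (simp add: cart_E Suc bra_simps scale_left_distrib)
  finally show ?case by (simp add: \<omega>_def algebra_simps)
qed

lemma FE: "bra F E = - cart \<kappa>"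
  using skew_even[OF EF_even] EF by simp

lemma F_w_0: "bra F (w 0) = 0"
  by (simp add: F_w0)

lemma F_w_Suc: "bra F (w (Suc n)) = scl (- d (Suc n)) (w n)"
proof (induction n)
  case 0
  show ?case
    using jacobi_even[OF EF_even(2,1), of w0] by (simp add: FE F_w0 bra_simps cart_w0 \<xi>_\<kappa> d_def)
next
  case (Suc n)
  have "bra F (w (Suc (Suc n))) = - bra (cart \<kappa>) (w (Suc n)) + bra E (bra F (w (Suc n)))"
    using jacobi_even[OF EF_even(2,1), of "w (Suc n)"] by (simp add: FE bra_simps)
  also have "\<dots> = scl (- (\<omega> (Suc n) \<kappa> + d (Suc n))) (w (Suc n))"
    using Suc cart_w[of \<kappa> "Suc n"] by (simp add: bra_simps scale_left_diff_distrib flip: w_simps(2))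
  also have "\<omega> (Suc n) \<kappa> + d (Suc n) = d (Suc (Suc n))"
    by (simp add: \<omega>_def d_def \<xi>_\<kappa> \<epsilon>_\<kappa> algebra_simps)
  finally show ?case .
qed

lemma E_E: "bra E E = 0"
proof -
  have "scl 2 (bra E E) = bra E E + bra E E"
    using scale_left_distrib[of 1 1 "bra E E"] by simp
  also have "\<dots> = 0" using skew_even[OF EF_even(1,1)] by (metis add.right_inverse)
  finally show ?thesis by simp
qed

lemma u_Suc_w: "bra (u (Suc n)) (w l) = bra F (bra (u n) (w l)) - bra (u n) (bra F (w l))"
  using jacobi_even[OF EF_even(2) u_odd, of n "w l"] by simp

text \<open>As \<open>E\<close> kills \<open>u0\<close>, the adjoint actions of \<open>u0\<close>
  and \<open>E\<close> commute. So \<open>[u0, w n]\<close> arises from \<open>cart \<eta>\<close>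
  by applying \<open>E\<close> repeatedly, which gives a multiple of \<open>E\<close> and then
  zero.\<close>

lemma u0_w: "bra u0 (w (Suc 0)) = scl (- r) E" "bra u0 (w (Suc (Suc n))) = 0"
proof -
  have step: "bra u0 (w (Suc n)) = bra E (bra u0 (w n))" for n
    using jacobi_even[OF EF_even(1) wu_odd(2), of "w n"] by (simp add: E_u0)
  have "bra E (cart \<eta>) = scl (- r) E"
    using skew_even[OF cart_even EF_even(1), of \<eta>] by (simp add: cart_E \<epsilon>_\<eta>)
  then show 1: "bra u0 (w (Suc 0)) = scl (- r) E" using step[of 0] by (simp add: u0_w0)
  show "bra u0 (w (Suc (Suc n))) = 0"
    by (induction n) (use step 1 in \<open>simp_all add: bra_simps E_E del: w_simps\<close>)
qed

text \<open>Moving one \<open>F\<close> out of \<open>u (Suc n)\<close> expresses its brackets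
  through those of \<open>u n\<close>. Each case draws on neighbouring ones, so all four are proved
  together. The multiple of \<open>F\<close> is left unspecified, as \<open>[F, F] = 0\<close> kills
  its further bracket with \<open>F\<close>.\<close>

lemma u_w:
  "bra (u n) (w n) = cart (g n) \<and> bra (u n) (w (Suc n)) = scl (- r / q * D (Suc n)) E \<and>
   (\<forall>l. n = Suc l \<longrightarrow> (\<exists>c. bra (u n) (w l) = scl c F)) \<and>
   (\<forall>l. Suc (Suc n) \<le> l \<or> Suc (Suc l) \<le> n \<longrightarrow> bra (u n) (w l) = 0)"
proof (induction n)
  case 0
  have "bra u0 (w l) = 0" if "Suc (Suc 0) \<le> l" for l
    using u0_w(2)[of "l - 2"] that by (metis Suc_diff_le add_2_eq_Suc' diff_Suc_Suc le_add_diff_inverse2 minus_nat.diff_0 numeral_2_eq_2)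
  moreover have "- r / q * D (Suc 0) = - r" using q_nonzero[of 0] by (simp add: D_simps d_def)
  ultimately show ?case using u0_w(1) by (simp add: u0_w0)
next
  case (Suc n)
  have g: "bra (u n) (w n) = cart (g n)" and e: "bra (u n) (w (Suc n)) = scl (- r / q * D (Suc n)) E"
    and f: "\<And>l. n = Suc l \<Longrightarrow> \<exists>c. bra (u n) (w l) = scl c F"
    and z: "\<And>l. Suc (Suc n) \<le> l \<or> Suc (Suc l) \<le> n \<Longrightarrow> bra (u n) (w l) = 0"
    using Suc by blast+
  have step: "bra (u (Suc n)) (w (Suc l)) = bra F (bra (u n) (w (Suc l))) + scl (d (Suc l)) (bra (u n) (w l))" for l
    unfolding u_Suc_w F_w_Suc by (simp add: bra_simps)
  have step0: "bra (u (Suc n)) (w 0) = bra F (bra (u n) (w 0))"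
    unfolding u_Suc_w F_w_0 by simp
  have F_cart: "bra F (cart h) = scl (\<epsilon> h) F" for h
    using skew_even[OF cart_even EF_even(2), of h] by (simp add: cart_F)
  have F_F: "bra F F = 0"
  proof -
    have "scl 2 (bra F F) = bra F F + bra F F"
      using scale_left_distrib[of 1 1 "bra F F"] by simp
    also have "\<dots> = 0" using skew_even[OF EF_even(2,2)] by (metis add.right_inverse)
    finally show ?thesis by simp
  qed
  have "bra (u (Suc n)) (w (Suc n)) = cart (g (Suc n))"
    unfolding step e g by (simp add: bra_simps FE cart_add cart_scale)
  moreover have "bra (u (Suc n)) (w (Suc (Suc n))) = scl (- r / q * D (Suc (Suc n))) E"
    unfolding step e using z[of "Suc (Suc n)"] by (simp add: D_simps mult_ac)
  moreover have "\<exists>c. bra (u (Suc n)) (w n) = scl c F"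
  proof (cases n)
    case 0
    then show ?thesis using step0 g by (auto simp: F_cart)
  next
    case (Suc l)
    then obtain c where "bra (u n) (w l) = scl c F" using f by blast
    then have "bra (u (Suc n)) (w (Suc l)) = scl (\<epsilon> (g n) + d (Suc l) * c) F"
      unfolding step using Suc g F_cart[of "g n"] by (simp add: scale_left_distrib del: w_simps u_simps)
    then show ?thesis using Suc by blast
  qed
  moreover have "bra (u (Suc n)) (w l) = 0" if "Suc (Suc (Suc n)) \<le> l \<or> Suc (Suc l) \<le> Suc n" for l
  proof (cases l)
    case 0
    then have "Suc 0 \<le> n" using that by simp
    then obtain m where m: "n = Suc m" by (cases n) auto
    show ?thesis
    proof (cases m)
      case 0
      then obtain c where "bra (u n) (w 0) = scl c F" using f m by blast
      then show ?thesis using step0 \<open>l = 0\<close> by (simp add: bra_simps F_F)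
    next
      case (Suc m')
      then show ?thesis using step0 z[of 0] m \<open>l = 0\<close> by simp
    qed
  next
    case (Suc k)
    have zk: "bra (u n) (w k) = 0" using z[of k] that Suc by auto
    have "bra F (bra (u n) (w (Suc k))) = 0"
    proof (cases "n = Suc (Suc k)")
      case True
      then obtain c where "bra (u n) (w (Suc k)) = scl c F" using f by blast
      then show ?thesis by (simp add: bra_simps F_F)
    next
      case False
      then show ?thesis using z[of "Suc k"] that Suc by auto
    qed
    then show ?thesis unfolding Suc step zk by simp
  qed
  ultimately show ?case by auto
qed

text \<open>Induction along the recursion for \<open>g\<close>, with \<open>\<kappa>\<close> acting
  on \<open>w l\<close> by \<open>q + 2 * l\<close>. The factor \<open>D n * r\<close> is
  independent of \<open>l\<close>, so sums over \<open>l\<close> are governed by the last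
  factor.\<close>

lemma \<omega>_g: "\<omega> l (g n) = D n * r * (of_nat n + of_nat l + 2 * of_nat n * of_nat l / q)"
proof (induction n)
  case 0
  show ?case by (simp add: \<omega>_def \<xi>_\<eta> \<epsilon>_\<eta> D_simps)
next
  case (Suc n)
  have q: "q \<noteq> 0" using q_nonzero[of 0] by simp
  have lin: "\<omega> l (h + h') = \<omega> l h + \<omega> l h'" "\<omega> l (sc c h) = c * \<omega> l h" for h h' c
    by (simp_all add: \<omega>_def \<epsilon>_add \<xi>_add \<epsilon>_scale \<xi>_scale algebra_simps)
  have \<kappa>: "\<omega> l \<kappa> = q + 2 * of_nat l" by (simp add: \<omega>_def \<xi>_\<kappa> \<epsilon>_\<kappa>)
  have "\<omega> l (g (Suc n)) = d (Suc n) * \<omega> l (g n) + r / q * D (Suc n) * \<omega> l \<kappa>"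
    by (simp add: lin)
  also have "\<dots> = D (Suc n) * r * (of_nat (Suc n) + of_nat l + 2 * of_nat (Suc n) * of_nat l / q)"
    unfolding Suc \<kappa> D_simps using q by (simp add: field_simps)
  finally show ?case .
qed

lemma w_degree:
  assumes "\<And>f g r s. f \<in> Deg r \<Longrightarrow> g \<in> Deg s \<Longrightarrow> bra f g \<in> Deg (r + s)" "E \<in> Deg e" "w0 \<in> Deg 1"
  shows "w n \<in> Deg (int n * e + 1)"
proof (induction n)
  case (Suc n)
  from assms(1)[OF assms(2) Suc] show ?case by (simp add: algebra_simps)
qed (use assms in simp)

end

text \<open>Odd elements \<open>w a\<close> and \<open>u a\<close> are paired off by even elements
  \<open>G a\<close> acting diagonally. The condition on sums of \<open>\<omega>\<close> lets the
  \<open>u a\<close> strip letters off an iterated bracket with nonzero factors.\<close>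

locale dual_odd_family = lie_superalgebra scl bra par for scl :: "'k::field \<Rightarrow> 'v::ab_group_add \<Rightarrow> 'v" and bra par +
  fixes w u G :: "nat \<Rightarrow> 'v" and \<omega> :: "nat \<Rightarrow> nat \<Rightarrow> 'k" and A :: "nat set"
  assumes w_odd: "w a \<in> par 1" and u_odd: "u a \<in> par 1" and G_even: "G a \<in> par 0"
    and u_w_neq: "a \<in> A \<Longrightarrow> b \<in> A \<Longrightarrow> a \<noteq> b \<Longrightarrow> bra (u a) (w b) = 0"
    and u_w_eq: "bra (u a) (w a) = G a"
    and G_w: "bra (G a) (w b) = scl (\<omega> a b) (w b)"
    and \<omega>_nonzero: "a \<in> A \<Longrightarrow> bs \<noteq> [] \<Longrightarrow> set bs \<subseteq> A \<Longrightarrow> (\<Sum>b\<leftarrow>bs. \<omega> a b) \<noteq> 0"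
    and G_nonzero: "a \<in> A \<Longrightarrow> G a \<noteq> 0"
begin

text \<open>Right-nested brackets whose last letter stands alone. With value 0 at the empty list,
  \<open>G_nest\<close> and \<open>u_nest_notin\<close> hold there too.\<close>

primrec nest :: "nat list \<Rightarrow> 'v" where
  "nest [] = 0"
| "nest (a # as) = (if as = [] then w a else bra (w a) (nest as))"

text \<open>Letters are stripped from the outside in; on a full match the last step produces some
  \<open>G a\<close>.\<close>

primrec detect :: "nat list \<Rightarrow> 'v \<Rightarrow> 'v" where
  "detect [] f = f"
| "detect (a # as) f = detect as (bra (u a) f)"

lemma detect_scale: "detect as (scl c f) = scl c (detect as f)"
  by (induction as arbitrary: f) (auto simp: bra_simps)

lemma detect_add: "detect as (f + f') = detect as f + detect as f'"
  by (induction as arbitrary: f f') (auto simp: bra_simps)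

lemma detect_zero [simp]: "detect as 0 = 0"
  by (induction as) auto

lemma detect_sum: "detect as (\<Sum>i\<in>S. f i) = (\<Sum>i\<in>S. detect as (f i))"
  by (induction S rule: infinite_finite_induct) (auto simp: detect_add)

lemma nest_degree:
  assumes "\<And>f g r s. f \<in> Deg r \<Longrightarrow> g \<in> Deg s \<Longrightarrow> bra f g \<in> Deg (r + s)" "\<And>a. w a \<in> Deg (deg a)" "as \<noteq> []"
  shows "nest as \<in> Deg (\<Sum>a\<leftarrow>as. deg a :: int)"
  using assms(3) by (induction as) (auto intro: assms)

lemma G_nest: "bra (G a) (nest bs) = scl (\<Sum>b\<leftarrow>bs. \<omega> a b) (nest bs)"
proof (induction bs)
  case (Cons b bs)
  show ?case
  proof (cases "bs = []")
    case False
    have "bra (G a) (nest (b # bs)) = bra (bra (G a) (w b)) (nest bs) + bra (w b) (bra (G a) (nest bs))"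
      using jacobi_even[OF G_even w_odd] False by simp
    then show ?thesis using False by (simp add: Cons G_w bra_simps scale_left_distrib)
  qed (simp add: G_w)
qed simp

lemma u_nest_notin: "a \<in> A \<Longrightarrow> set bs \<subseteq> A \<Longrightarrow> a \<notin> set bs \<Longrightarrow> bra (u a) (nest bs) = 0"
proof (induction bs)
  case (Cons b bs)
  then have "bra (u a) (w b) = 0" by (intro u_w_neq) auto
  then show ?case using Cons jacobi_odd[OF u_odd w_odd, of a b "nest bs"] by auto
qed simp

text \<open>The odd derivation given by \<open>u a\<close> kills the tail, so only the first letter
  contributes, turning into \<open>G a\<close>, which acts by a scalar. The tail must be nonempty,
  since \<open>[u a, w a]\<close> is \<open>G a\<close> itself.\<close>

lemma u_nest_head:
  "a \<in> A \<Longrightarrow> set bs \<subseteq> A \<Longrightarrow> a \<notin> set bs \<Longrightarrow> bs \<noteq> [] \<Longrightarrow>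
    bra (u a) (nest (a # bs)) = scl (\<Sum>b\<leftarrow>bs. \<omega> a b) (nest bs)"
  using jacobi_odd[OF u_odd w_odd, of a a "nest bs"] u_nest_notin[of a bs] by (simp add: u_w_eq G_nest)

lemma detect_nest: "as \<noteq> [] \<Longrightarrow> set as \<subseteq> A \<Longrightarrow> distinct as \<Longrightarrow> detect as (nest as) \<noteq> 0"
proof (induction as)
  case (Cons a as)
  show ?case
  proof (cases "as = []")
    case True
    then show ?thesis using Cons.prems G_nonzero by (simp add: u_w_eq)
  next
    case False
    then show ?thesis
      using Cons u_nest_head[of a as] \<omega>_nonzero[of a as] by (simp add: detect_scale)
  qed
qed simp

text \<open>The classes \<open>cls\<close> mark positions: as the class sequences agree without
  repetition, a letter of \<open>as\<close> can occur in \<open>bs\<close> only at its own position.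
  At the first discrepancy it is absent from what remains of \<open>bs\<close>, and the bracket
  vanishes.\<close>

lemma detect_nest_neq:
  assumes "map cls as = map cls bs" "distinct (map cls as)" "as \<noteq> bs" "set as \<subseteq> A" "set bs \<subseteq> A"
  shows "detect as (nest bs) = 0"
  using assms
proof (induction as arbitrary: bs)
  case (Cons a as)
  from Cons.prems(1) obtain b bs' where bs: "bs = b # bs'" "cls a = cls b" "map cls as = map cls bs'"
    by (cases bs) auto
  have "cls a \<notin> set (map cls bs')" using Cons.prems(2) unfolding bs(3)[symmetric] by simp
  then have notin: "a \<notin> set bs'" by auto
  show ?case
  proof (cases "a = b")
    case False
    then show ?thesis using u_nest_notin[of a bs] notin bs Cons.prems by simp
  next
    case True
    then have "as \<noteq> bs'" "as \<noteq> []" "bs' \<noteq> []" using Cons.prems(3) bs by auto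
    then show ?thesis
      using Cons.IH[of bs'] Cons.prems bs u_nest_head[of a bs'] notin True
      by (simp add: detect_scale del: nest.simps)
  qed
qed simp

text \<open>Applying \<open>detect bs\<close> to the relation kills every summand except that of
  \<open>bs\<close>, which becomes a multiple of a nonzero vector.\<close>

lemma nest_independent:
  assumes S: "finite S" "\<And>as. as \<in> S \<Longrightarrow> as \<noteq> [] \<and> set as \<subseteq> A \<and> map cls as = cs" "distinct cs"
    and sum: "(\<Sum>as\<in>S. scl (c as) (nest as)) = 0" and bs: "bs \<in> S"
  shows "c bs = 0"
proof -
  have "detect bs (scl (c as) (nest as)) = (if as = bs then scl (c bs) (detect bs (nest bs)) else 0)" if "as \<in> S" for as
    using detect_nest_neq[of cls bs as] S(2)[OF that] S(2)[OF bs] S(3) by (auto simp: detect_scale)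
  then have "0 = (\<Sum>as\<in>S. if as = bs then scl (c bs) (detect bs (nest bs)) else 0)"
    using arg_cong[OF sum, of "detect bs"] by (simp add: detect_sum)
  then have "scl (c bs) (detect bs (nest bs)) = 0" using S(1) bs by simp
  moreover have "distinct bs" using S(2)[OF bs] S(3) distinct_map by metis
  then have "detect bs (nest bs) \<noteq> 0" using detect_nest S(2)[OF bs] by blast
  ultimately show ?thesis by simp
qed

end

section \<open>The odd root vector of weight \<open>\<alpha>\<^sub>1 + \<alpha>\<^sub>2 + \<alpha>\<^sub>3\<close>\<close>

text \<open>The indices are parameters so that the results apply to each cyclic rotation of the
  simple roots.\<close>

locale q_algebra = contragredient_algebra scl bra par sc hv \<alpha> p cart x y
  for scl :: "'k::field_char_0 \<Rightarrow> 'v::ab_group_add \<Rightarrow> 'v" and bra par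
    and sc :: "'k \<Rightarrow> 'h::ab_group_add \<Rightarrow> 'h" and hv :: "'n \<Rightarrow> 'h" and \<alpha> p cart x y +
  fixes i j k :: 'n and a b c :: 'k
  assumes distinct: "distinct [i, j, k]" and odd: "p i = 1" "p j = 1" "p k = 1"
    and \<alpha>_add: "\<alpha> l (h + h') = \<alpha> l h + \<alpha> l h'" and \<alpha>_scale: "\<alpha> l (sc z h) = z * \<alpha> l h"
    and matrix [simp]: "\<alpha> i (hv i) = 0" "\<alpha> j (hv i) = 1" "\<alpha> k (hv i) = a"
      "\<alpha> i (hv j) = b" "\<alpha> j (hv j) = 0" "\<alpha> k (hv j) = 1"
      "\<alpha> i (hv k) = 1" "\<alpha> j (hv k) = c" "\<alpha> k (hv k) = 0"
begin

lemma x_odd: "x i \<in> par 1" "x j \<in> par 1" "x k \<in> par 1"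
  using x_par[of i] x_par[of j] x_par[of k] odd by simp_all

lemma y_odd: "y i \<in> par 1" "y j \<in> par 1" "y k \<in> par 1"
  using y_par[of i] y_par[of j] y_par[of k] odd by simp_all

lemma neq [simp]: "i \<noteq> j" "i \<noteq> k" "j \<noteq> k" "j \<noteq> i" "k \<noteq> i" "k \<noteq> j"
  using distinct by auto

text \<open>Up to a scalar, \<open>e\<close> is the only vector of its weight annihilated by \<open>y i\<close>, and \<open>f\<close> the only
  one annihilated by \<open>x i\<close>. In the notation of the theorem, \<open>M\<close> is \<open>b m\<close> and \<open>T\<close> is \<open>a t\<close>.\<close>

definition e :: 'v where
  "e = scl a (bra (x i) (bra (x j) (x k))) + scl (1 + a) (bra (x j) (bra (x i) (x k)))"
definition f :: 'v where
  "f = scl a (bra (y i) (bra (y j) (y k))) + scl (1 + a) (bra (y j) (bra (y i) (y k)))"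
definition M :: 'k where "M = 1 + b + a * b"
definition T :: 'k where "T = 1 + a + a * c"
definition H :: 'h where
  "H = sc (- M - a * b * T) (hv i) + sc (- (1 + a) * T) (hv j) + sc (- (1 + a) * a * M) (hv k)"
definition \<beta> :: "'h \<Rightarrow> 'k" where "\<beta> h = \<alpha> i h + \<alpha> j h + \<alpha> k h"

lemma y_x: "l \<in> {i, j, k} \<Longrightarrow> m \<in> {i, j, k} \<Longrightarrow> bra (y l) (x m) = (if l = m then cart (hv l) else 0)"
  using skew_odd[of "x m" "y l"] x_odd y_odd x_y[of m l] by auto

lemma y_x_z: "l \<in> {i, j, k} \<Longrightarrow> m \<in> {i, j, k} \<Longrightarrow>
    bra (y l) (bra (x m) z) = (if l = m then bra (cart (hv l)) z else 0) - bra (x m) (bra (y l) z)"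
  using jacobi_odd[of "y l" "x m" z] y_x[of l m] x_odd y_odd by auto

lemma x_y_z: "l \<in> {i, j, k} \<Longrightarrow> m \<in> {i, j, k} \<Longrightarrow>
    bra (x l) (bra (y m) z) = (if l = m then bra (cart (hv l)) z else 0) - bra (y m) (bra (x l) z)"
  using jacobi_odd[of "x l" "y m" z] x_y[of l m] x_odd y_odd by auto

lemma cart_x_z: "bra (cart h) (bra (x m) z) = scl (\<alpha> m h) (bra (x m) z) + bra (x m) (bra (cart h) z)"
  using jacobi_even[OF cart_even x_par, of h m z] by (simp add: cart_x bra_simps)

lemma cart_y_z: "bra (cart h) (bra (y m) z) = scl (- \<alpha> m h) (bra (y m) z) + bra (y m) (bra (cart h) z)"
  using jacobi_even[OF cart_even y_par, of h m z] by (simp add: cart_y bra_simps)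

text \<open>These rules move an outer \<open>x\<close> or \<open>y\<close> inward past generators of
  the opposite sign and evaluate Cartan elements as scalars, which turns bracket identities into
  arithmetic.\<close>

lemmas reduce = y_x y_x_z x_y x_y_z cart_x cart_y cart_x_z cart_y_z x_cart y_cart bra_simps

text \<open>\<open>y i\<close> takes the two brackets in \<open>e\<close> to \<open>1 + a\<close>
  and \<open>- a\<close> times \<open>[x j, x k]\<close>; the coefficients \<open>a\<close> and
  \<open>1 + a\<close> balance these.\<close>

lemma y_e: "bra (y i) e = 0" "bra (y j) e = scl M (bra (x i) (x k))" "bra (y k) e = scl (- T) (bra (x i) (x j))"
  using skew_odd[OF x_odd(2,1)]
  by (simp_all add: e_def M_def T_def reduce scale_left_distrib scale_right_distrib algebra_simps)

lemma x_f: "bra (x i) f = 0"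
  by (simp add: f_def reduce scale_left_distrib scale_right_distrib algebra_simps)

lemma e_odd: "e \<in> par 1" and f_odd: "f \<in> par 1"
proof -
  have "bra p1 (bra p2 p3) \<in> par 1" if "p1 \<in> par 1" "p2 \<in> par 1" "p3 \<in> par 1" for p1 p2 p3
    using par_bra[OF that(1) par_bra[OF that(2,3)]] by simp
  then show "e \<in> par 1" "f \<in> par 1"
    unfolding e_def f_def using x_odd y_odd by (auto intro!: par_add par_scale)
qed

text \<open>With \<open>y_y_y_z\<close>, this expands the adjoint action of \<open>f\<close> into
  successive actions of single \<open>y\<close>, to which \<open>y_e\<close> applies.\<close>

lemma y_y_z: "l \<in> {i, j, k} \<Longrightarrow> m \<in> {i, j, k} \<Longrightarrow>
    bra (bra (y l) (y m)) z = bra (y l) (bra (y m) z) + bra (y m) (bra (y l) z)"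
proof -
  assume "l \<in> {i, j, k}" "m \<in> {i, j, k}"
  then have "y l \<in> par 1" "y m \<in> par 1" using y_odd by auto
  from jacobi_odd[OF this, of z] show ?thesis by simp
qed

lemma y_y_y_z: "l \<in> {i, j, k} \<Longrightarrow> m \<in> {i, j, k} \<Longrightarrow> n \<in> {i, j, k} \<Longrightarrow>
    bra (bra (y l) (bra (y m) (y n))) z =
      bra (y l) (bra (bra (y m) (y n)) z) - bra (bra (y m) (y n)) (bra (y l) z)"
proof -
  assume *: "l \<in> {i, j, k}" "m \<in> {i, j, k}" "n \<in> {i, j, k}"
  have "bra (y m) (y n) \<in> par 0" using * y_odd par_bra[of "y m" 1 "y n" 1] by auto
  then show ?thesis using jacobi_odd_even[of "y l" "bra (y m) (y n)" z] * y_odd by auto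
qed

lemma f_e: "bra f e = cart H"
  by (simp add: f_def bra_simps y_y_y_z y_y_z y_e H_def cart_add cart_scale)
     (simp add: reduce scale_left_distrib scale_right_distrib algebra_simps)

lemma cart_e: "bra (cart h) e = scl (\<beta> h) e"
  by (simp add: e_def \<beta>_def reduce scale_left_distrib scale_right_distrib algebra_simps)

lemma cart_f: "bra (cart h) f = scl (- \<beta> h) f"
  by (simp add: f_def \<beta>_def reduce scale_left_distrib scale_right_distrib algebra_simps)

text \<open>With \<open>\<alpha>_H\<close>, this determines the weight
  \<open>\<alpha> i H / \<beta> H\<close> of the string; the factor \<open>1 + a\<close> cancels
  when it is nonzero.\<close>

lemma \<beta>_H: "\<beta> H = - 2 * (1 + a) * M * T"
  by (simp add: \<beta>_def H_def \<alpha>_add \<alpha>_scale) (simp add: M_def T_def algebra_simps)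

lemma \<alpha>_H: "\<alpha> i H = - (1 + a) * (b * T + a * M)"
  by (simp add: H_def \<alpha>_add \<alpha>_scale algebra_simps)

end

locale q_algebra_string = q_algebra scl bra par sc hv \<alpha> p cart x y i j k a b c
  for scl :: "'k::field_char_0 \<Rightarrow> 'v::ab_group_add \<Rightarrow> 'v" and bra par
    and sc :: "'k \<Rightarrow> 'h::ab_group_add \<Rightarrow> 'h" and hv :: "'n \<Rightarrow> 'h" and \<alpha> p cart x y i j k a b c +
  assumes \<beta>_H_nonzero: "\<beta> H \<noteq> 0"
    and ratio: "\<alpha> i H / \<beta> H + of_nat n \<noteq> 0"
begin

section \<open>The sl2-triple formed from the squares of \<open>e\<close> and
  \<open>f\<close>\<close>

lemma f_e_e: "bra f (bra e e) = scl (2 * \<beta> H) e"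
proof -
  have "bra e (cart H) = scl (- \<beta> H) e"
    using skew_even[OF cart_even e_odd, of H] by (simp add: cart_e)
  then have "bra f (bra e e) = scl (\<beta> H + \<beta> H) e"
    unfolding jacobi_odd[OF f_odd e_odd] f_e scale_left_distrib by (simp add: cart_e)
  then show ?thesis by (simp only: mult_2)
qed

lemma square_z: "g \<in> par 1 \<Longrightarrow> bra (bra g g) z = scl 2 (bra g (bra g z))"
  using jacobi_odd[of g g z] scale_left_distrib[of 1 1 "bra g (bra g z)"] by (simp add: eq_diff_eq)

text \<open>The bracket of \<open>[f, f]\<close> with \<open>[e, e]\<close> is
  \<open>4 * \<beta> H\<close> times \<open>H\<close>. The scalar in front of \<open>[f, f]\<close>
  is chosen so that \<open>[E, F]\<close> is \<open>H / \<beta> H\<close>, on which the weight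
  \<open>2 * \<beta>\<close> of \<open>E\<close> equals 2.\<close>

sublocale sl2_string scl bra par sc hv \<alpha> p cart x y "bra e e" "scl (- 1 / (4 * (\<beta> H)\<^sup>2)) (bra f f)" "x i" "y i"
  "sc (1 / \<beta> H) H" "hv i" "\<lambda>h. 2 * \<beta> h" "\<alpha> i" "\<alpha> i H / \<beta> H" "2 * (1 + a)"
proof unfold_locales
  show E: "bra e e \<in> par 0" using par_bra[OF e_odd e_odd] by simp
  have F: "bra f f \<in> par 0" using par_bra[OF f_odd f_odd] by simp
  show "scl (- 1 / (4 * (\<beta> H)\<^sup>2)) (bra f f) \<in> par 0" by (rule par_scale[OF F])
  show "x i \<in> par 1" "y i \<in> par 1" by (fact x_odd y_odd)+
  have "bra (bra f f) (bra e e) = scl (4 * \<beta> H) (cart H)"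
    by (simp add: square_z[OF f_odd] f_e_e f_e bra_simps)
  then have "bra (bra e e) (bra f f) = scl (- 4 * \<beta> H) (cart H)"
    using skew_even[OF F E] by simp
  then show "bra (bra e e) (scl (- 1 / (4 * (\<beta> H)\<^sup>2)) (bra f f)) = cart (sc (1 / \<beta> H) H)"
    using \<beta>_H_nonzero by (simp add: bra_simps cart_scale power2_eq_square)
  show "bra (y i) (x i) = cart (hv i)" by (simp add: y_x)
  have "bra f (x i) = 0" "bra e (y i) = 0"
    using skew_odd[OF f_odd x_odd(1)] skew_odd[OF e_odd y_odd(1)] x_f y_e by simp_all
  then show "bra (scl (- 1 / (4 * (\<beta> H)\<^sup>2)) (bra f f)) (x i) = 0" "bra (bra e e) (y i) = 0"
    by (simp_all add: bra_simps square_z[OF f_odd] square_z[OF e_odd])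
  have cart_sq: "bra (cart h) (bra g g) = scl (2 * c) (bra g g)"
    if g: "g \<in> par 1" "bra (cart h) g = scl c g" for g h c
  proof -
    have "bra (cart h) (bra g g) = scl (c + c) (bra g g)"
      unfolding jacobi_even[OF cart_even g(1)] g(2) scale_left_distrib by (simp add: bra_simps)
    then show ?thesis by (simp only: mult_2)
  qed
  fix h h' :: 'h and z :: 'k and n :: nat
  show "bra (cart h) (bra e e) = scl (2 * \<beta> h) (bra e e)"
    using cart_sq[OF e_odd cart_e] by simp
  show "bra (cart h) (scl (- 1 / (4 * (\<beta> H)\<^sup>2)) (bra f f)) =
      scl (- (2 * \<beta> h)) (scl (- 1 / (4 * (\<beta> H)\<^sup>2)) (bra f f))"
    using cart_sq[OF f_odd cart_f] by (simp add: bra_simps)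
  show "bra (cart h) (x i) = scl (\<alpha> i h) (x i)" by (rule cart_x)
  show "2 * \<beta> (h + h') = 2 * \<beta> h + 2 * \<beta> h'" "2 * \<beta> (sc z h) = z * (2 * \<beta> h)"
    by (simp_all add: \<beta>_def \<alpha>_add \<alpha>_scale algebra_simps)
  show "\<alpha> i (h + h') = \<alpha> i h + \<alpha> i h'" "\<alpha> i (sc z h) = z * \<alpha> i h" by (rule \<alpha>_add \<alpha>_scale)+
  have "\<beta> (sc (1 / \<beta> H) H) = 1" using \<beta>_H_nonzero
    by (simp add: \<beta>_def \<alpha>_scale add_divide_distrib[symmetric])
  then show "2 * \<beta> (sc (1 / \<beta> H) H) = 2" by simp
  show "\<alpha> i (sc (1 / \<beta> H) H) = \<alpha> i H / \<beta> H" by (simp add: \<alpha>_scale)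
  show "2 * \<beta> (hv i) = 2 * (1 + a)" by (simp add: \<beta>_def)
  show "\<alpha> i (hv i) = 0" by simp
  show "\<alpha> i H / \<beta> H + of_nat n \<noteq> 0" by (rule ratio)
qed

text \<open>\<open>e\<close> is a combination of threefold brackets of the \<open>x\<close>, so
  bracketing with \<open>[e, e]\<close> raises the degree by 6.\<close>

lemma w_degree_q:
  assumes bra: "\<And>f g r s. f \<in> Deg r \<Longrightarrow> g \<in> Deg s \<Longrightarrow> bra f g \<in> Deg (r + s :: int)"
    and add: "\<And>f g r. f \<in> Deg r \<Longrightarrow> g \<in> Deg r \<Longrightarrow> f + g \<in> Deg r"
    and scale: "\<And>f c r. f \<in> Deg r \<Longrightarrow> scl c f \<in> Deg r"
    and x: "\<And>l. x l \<in> Deg 1"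
  shows "w n \<in> Deg (6 * int n + 1)"
proof -
  have "bra (x l) (bra (x m) (x n)) \<in> Deg 3" for l m n
    using bra[OF x[of l] bra[OF x[of m] x[of n]]] by simp
  then have "e \<in> Deg 3" unfolding e_def by (intro add scale)
  then have "bra e e \<in> Deg 6" using bra[of e 3 e 3] by simp
  from w_degree[OF bra this x] show ?thesis by (simp add: mult.commute)
qed

end

section \<open>Growth\<close>

text \<open>Independence forces the family to be injective, so counting indices counts
  vectors.\<close>

lemma (in vector_space) card_le_of_independent_family:
  assumes S: "finite S" "\<And>c. (\<Sum>s\<in>S. scale (c s) (v s)) = 0 \<Longrightarrow> \<forall>s\<in>S. c s = 0"
    and B: "finite B" "v ` S \<subseteq> span B"
  shows "card S \<le> card B"
proof -
  have inj: "inj_on v S"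
  proof (rule inj_onI, rule ccontr)
    fix s t assume st: "s \<in> S" "t \<in> S" "v s = v t" "s \<noteq> t"
    let ?c = "\<lambda>x. (if x = s then 1 else 0) - (if x = t then 1 else 0)"
    have "scale (?c x) (v x) = (if x = s then v s else 0) - (if x = t then v t else 0)" for x
      by auto
    then have "(\<Sum>x\<in>S. scale (?c x) (v x)) = v s - v t"
      using S(1) st by (simp add: sum_subtractf)
    then have "(\<Sum>x\<in>S. scale (?c x) (v x)) = 0" using st(3) by simp
    from bspec[OF S(2)[OF this] st(1)] show False using st(4) by simp
  qed
  have "independent (v ` S)"
  proof
    assume "dependent (v ` S)"
    then obtain c where c: "\<exists>x\<in>v ` S. c x \<noteq> 0" "(\<Sum>x\<in>v ` S. scale (c x) x) = 0"
      using dependent_finite[of "v ` S"] S(1) by auto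
    then have "(\<Sum>s\<in>S. scale (c (v s)) (v s)) = 0" by (simp add: sum.reindex[OF inj])
    then show False using S(2)[of "\<lambda>s. c (v s)"] c(1) by auto
  qed
  from independent_span_bound[OF B(1) this B(2)] show ?thesis using card_image[OF inj] by simp
qed

text \<open>A strict bound by \<open>Suc N\<close> on the infimum yields an actual spanning
  set.\<close>

lemma quotient_dim_leD:
  assumes "quotient_dim I V \<le> enat N"
  obtains B where "finite B" "card B \<le> N" "V \<subseteq> free.span (I \<union> B)"
proof -
  have "quotient_dim I V < enat (Suc N)" using assms by (simp add: order_le_less_trans)
  then show ?thesis unfolding quotient_dim_def INF_less_iff using that by auto
qed

lemma (in quotient_projection) nf_span_Un: "f \<in> free.span (J \<union> B) \<Longrightarrow> nf f \<in> free.span (nf ` B)"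
proof (induction rule: free.span_induct_alt)
  case base
  then show ?case by (simp add: free.span_zero)
next
  case (step c f g)
  have "nf f \<in> free.span (nf ` B)"
    using step(1) nf_eq_0[of f] by (auto simp: free.span_zero intro: free.span_base)
  then show ?case using step(2) by (simp add: nf_add nf_scale free.span_add free.span_scale)
qed

section \<open>Comparison of polynomials with powers\<close>

lemma nat_poly_bound: "n \<ge> 1 \<Longrightarrow> poly Q n \<le> (\<Sum>i\<le>degree Q. coeff Q i) * n ^ degree Q" for Q :: "nat poly"
  unfolding poly_altdef sum_distrib_right
  by (intro sum_mono mult_left_mono power_increasing) auto

lemma nat_poly_mono: "m \<le> n \<Longrightarrow> poly Q m \<le> poly Q n" for Q :: "nat poly"
  unfolding poly_altdef by (intro sum_mono mult_left_mono power_mono) auto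

text \<open>The left side is a polynomial in \<open>n\<close> of degree at most
  \<open>degree Q + 1\<close>. If \<open>C\<close> is the sum of its coefficients, it is already
  beaten by the next power at \<open>n = C + 1\<close>.\<close>

lemma exists_poly_linear_less_power:
  fixes Q :: "nat poly"
  shows "\<exists>n. (l * n + d + 1) * poly Q (l * n + d) < n ^ (degree Q + 2)"
proof -
  define R where "R = [:d + 1, l:] * pcompose Q [:d, l:]"
  have R: "poly R n = (l * n + d + 1) * poly Q (l * n + d)" for n
    by (simp add: R_def poly_pcompose algebra_simps)
  have "degree (pcompose Q [:d, l:]) \<le> degree Q * degree [:d, l:]" by (rule degree_pcompose_le)
  also have "\<dots> \<le> degree Q * 1" by (intro mult_left_mono) auto
  finally have "degree R \<le> 1 + degree Q"
    unfolding R_def by (intro order.trans[OF degree_mult_le] add_mono) auto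
  define C where "C = (\<Sum>i\<le>degree R. coeff R i)"
  have "poly R (C + 1) \<le> C * (C + 1) ^ degree R"
    unfolding C_def by (rule nat_poly_bound) simp
  also have "\<dots> \<le> C * (C + 1) ^ (1 + degree Q)"
    using \<open>degree R \<le> 1 + degree Q\<close> by (intro mult_left_mono power_increasing) auto
  also have "\<dots> < (C + 1) * (C + 1) ^ (1 + degree Q)" by simp
  finally show ?thesis using R by (intro exI[of _ "C + 1"]) simp
qed

lemma realization_linear:
  assumes "realization sc A hv \<alpha>"
  shows "\<alpha> i (x + y) = \<alpha> i x + \<alpha> i y" "\<alpha> i (sc c x) = c * \<alpha> i x" "\<alpha> j (hv i) = A $ i $ j"
proof -
  have "Vector_Spaces.linear sc (*) (\<alpha> i)"
    using assms unfolding realization_def by (elim conjE) (rule spec)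
  then show "\<alpha> i (x + y) = \<alpha> i x + \<alpha> i y" "\<alpha> i (sc c x) = c * \<alpha> i x"
    by (auto simp: Vector_Spaces.linear_iff)
  show "\<alpha> j (hv i) = A $ i $ j"
    using assms unfolding realization_def by (elim conjE) (drule spec, drule spec, assumption)
qed

text \<open>Every summand is negative: \<open>a + b\<close> is at most \<open>2 * a * b\<close> for
  \<open>a\<close> and \<open>b\<close> at least 1, and dividing by \<open>- q < 1\<close> enlarges
  the product. This fails for index 0, which is therefore excluded below.\<close>

lemma sum_ratio_neg:
  fixes q :: real
  assumes q: "-1 < q" "q < 0" and "a \<ge> 1" "bs \<noteq> []" "\<And>b. b \<in> set bs \<Longrightarrow> b \<ge> 1"
  shows "(\<Sum>b\<leftarrow>bs. real a + real b + 2 * real a * real b / q) < 0"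
  using assms(4,5)
proof (induction bs)
  case (Cons b bs)
  have ab: "real a \<ge> 1" "real b \<ge> 1" using assms(3) Cons.prems(2)[of b] by simp_all
  then have "(real a - 1) * (real b - 1) \<ge> 0" by (intro mult_nonneg_nonneg) auto
  moreover have "1 * 1 \<le> real a * real b" using ab by (intro mult_mono) auto
  ultimately have "real a + real b \<le> 2 * real a * real b" by (simp add: algebra_simps)
  also have "2 * real a * real b * - q < 2 * real a * real b * 1"
    using q ab by (intro mult_strict_left_mono) auto
  then have "2 * real a * real b < 2 * real a * real b / - q"
    using q by (subst pos_less_divide_eq) auto
  finally have "real a + real b + 2 * real a * real b / q < 0" by simp
  moreover have "(\<Sum>b\<leftarrow>bs. real a + real b + 2 * real a * real b / q) \<le> 0"
  proof (cases "bs = []")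
    case False
    then show ?thesis using Cons.prems(2) by (intro less_imp_le[OF Cons.IH]) auto
  qed simp
  ultimately show ?case by simp
qed simp

text \<open>\<open>M'\<close> and \<open>T'\<close> are the real counterparts of \<open>M\<close>
  and \<open>T\<close>, and \<open>q\<close> is the weight of \<open>X i\<close>; stating its bounds
  over the reals makes the sign argument available.\<close>

lemma not_finite_growth:
  fixes sc :: "complex \<Rightarrow> 'h::ab_group_add \<Rightarrow> 'h" and A :: "complex^'n^'n"
    and hv :: "'n \<Rightarrow> 'h" and \<alpha> :: "'n \<Rightarrow> 'h \<Rightarrow> complex" and a b c :: real
  assumes real: "realization sc A hv \<alpha>" and ijk: "distinct [i, j, k]" "p i = 1" "p j = 1" "p k = 1"
    and A: "A $ i $ i = 0" "A $ i $ j = 1" "A $ i $ k = of_real a"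
      "A $ j $ i = of_real b" "A $ j $ j = 0" "A $ j $ k = 1"
      "A $ k $ i = 1" "A $ k $ j = of_real c" "A $ k $ k = 0"
    and M': "M' = 1 + b + a * b" "M' \<noteq> 0" and T': "T' = 1 + a + a * c" "T' \<noteq> 0" and a: "1 + a \<noteq> 0"
    and q: "q = (b * T' + a * M') / (2 * M' * T')" "-1 < q" "q < 0"
  shows "\<not> finite_growth sc hv \<alpha> p"
proof
  assume "finite_growth sc hv \<alpha> p"
  then obtain P :: "nat poly" where
    P: "contragredient_dim sc hv \<alpha> p r \<le> enat (poly P (nat \<bar>r\<bar>))" for r
    unfolding finite_growth_def by blast
  define I where "I = contragredient_ideal sc hv \<alpha> p"
  obtain x0 where x0: "\<And>i. \<alpha> i x0 = 1"
    using realization_dual_point[OF real, of "\<lambda>_. 1"] by blast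
  note I = contragredient_ideal_greatest[where sc = sc and hv = hv and \<alpha> = \<alpha> and p = p, OF x0, folded I_def]
  note lin = realization_linear[OF real]
  interpret word: word_representation sc hv \<alpha> p
    by unfold_locales (rule lin)+
  obtain nf where nf: "\<And>f g. nf (f + g) = nf f + nf g" "\<And>c f. nf (fscale c f) = fscale c (nf f)"
    "\<And>f. nf (nf f) = nf f" "\<And>f. nf f = 0 \<longleftrightarrow> f \<in> I"
    using exists_quotient_projection[OF super_ideal_subspace[OF conjunct1[OF I]]] by metis
  have "relators sc hv \<alpha> p \<subseteq> I" using I relators_subset by blast
  then interpret quotient_projection sc hv \<alpha> p I nf
    using I nf by unfold_locales auto
  let ?bra = "\<lambda>f g. nf (br f g)" and ?par = "\<lambda>\<epsilon>. nf ` parity_part p \<epsilon>"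
    and ?cart = "\<lambda>h. nf (gen (Cartan h))" and ?x = "\<lambda>i. nf (gen (X i))" and ?y = "\<lambda>i. nf (gen (Y i))"
  \<comment> \<open>A Cartan element in \<open>I\<close> lies in the relation ideal, and there the
    word representation forces every simple root to vanish.\<close>
  have cart_nz: "\<alpha> l h = 0" if "?cart h = 0" for l h
    using that I nf(4) word.relation_ideal_Cartan by blast
  interpret q_algebra fscale ?bra ?par sc hv \<alpha> p ?cart ?x ?y i j k "of_real a" "of_real b" "of_real c"
    by unfold_locales (use ijk lin A in auto)
  have MT: "M = of_real M'" "T = of_real T'"
    by (simp_all add: M_def T_def M' T')
  have a': "1 + complex_of_real a \<noteq> 0" using a by (metis of_real_1 of_real_add of_real_eq_0_iff)
  have "\<beta> H = of_real (- 2 * (1 + a) * M' * T')" by (simp add: \<beta>_H MT)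
  moreover have "- 2 * (1 + a) * M' * T' \<noteq> 0"
    using a M'(2) T'(2) by (simp only: mult_eq_0_iff) simp
  ultimately have \<beta>_nz: "\<beta> H \<noteq> 0" by (simp only: of_real_eq_0_iff not_False_eq_True)
  have ratio_q: "\<alpha> i H / \<beta> H = of_real q"
  proof -
    have "- u * v / (- 2 * u * y * z) = v / (2 * y * z)" if "u \<noteq> 0" for u v y z :: complex
      using that by (simp add: divide_simps)
    from this[OF a'] show ?thesis unfolding \<alpha>_H \<beta>_H MT q(1) by simp
  qed
  have "of_real q + of_nat n \<noteq> (0::complex)" for n
  proof -
    have "q + real n \<noteq> 0" using q(2,3) by (cases n) auto
    then show ?thesis by (metis of_real_add of_real_eq_0_iff of_real_of_nat_eq)
  qed
  then interpret q_algebra_string fscale ?bra ?par sc hv \<alpha> p ?cart ?x ?y i j k "of_real a" "of_real b" "of_real c"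
    by unfold_locales (use \<beta>_nz a' ratio_q in auto)
  have \<omega>_sum: "(\<Sum>l\<leftarrow>ls. \<omega> l (g n)) \<noteq> 0" if "n \<ge> 1" "ls \<noteq> []" "\<And>l. l \<in> set ls \<Longrightarrow> l \<ge> 1" for n ls
  proof -
    have "(\<Sum>l\<leftarrow>ls. \<omega> l (g n)) =
      D n * (2 * (1 + of_real a)) * of_real (\<Sum>l\<leftarrow>ls. real n + real l + 2 * real n * real l / q)"
    proof -
      have "\<omega> l (g n) = D n * (2 * (1 + of_real a)) * of_real (real n + real l + 2 * real n * real l / q)" for l
        using \<omega>_g[of l n] by (simp add: ratio_q)
      then show ?thesis by (induction ls) (simp_all only: list.map sum_list.Nil sum_list.Cons of_real_0 of_real_add mult_zero_right distrib_left)
    qed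
    moreover have "D n * (2 * (1 + complex_of_real a)) \<noteq> 0"
      using D_nonzero a' by (simp only: mult_eq_0_iff) simp
    moreover have "complex_of_real (\<Sum>l\<leftarrow>ls. real n + real l + 2 * real n * real l / q) \<noteq> 0"
      unfolding of_real_eq_0_iff using sum_ratio_neg[OF q(2,3) that] by linarith
    ultimately show ?thesis by (simp only: mult_eq_0_iff) simp
  qed
  have \<omega>_zero: "\<omega> n h = 0" if "?cart h = 0" for n h
  proof -
    have "\<beta> h = 0" by (simp add: \<beta>_def cart_nz[OF that])
    then show ?thesis using \<omega>_def[of n h] cart_nz[OF that, of i] by simp
  qed
  \<comment> \<open>\<open>u n\<close> and \<open>w l\<close> need not commute when \<open>n\<close> and \<open>l\<close> are adjacent, hence the even indices.\<close>
  define A' where "A' = {n::nat. even n \<and> n \<ge> 1}"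
  have A'_far: "Suc (Suc n) \<le> l \<or> Suc (Suc l) \<le> n" if "n \<in> A'" "l \<in> A'" "n \<noteq> l" for n l
    using that unfolding A'_def by (auto elim!: evenE)
  interpret dual: dual_odd_family fscale ?bra ?par w u "\<lambda>n. ?cart (g n)" "\<lambda>n l. \<omega> l (g n)" A'
  proof unfold_locales
    show "w n \<in> ?par 1" "u n \<in> ?par 1" "?cart (g n) \<in> ?par 0" for n
      by (rule w_odd u_odd cart_even)+
    show "?bra (u n) (w l) = 0" if "n \<in> A'" "l \<in> A'" "n \<noteq> l" for n l
      using u_w A'_far[OF that] by blast
    show "?bra (u n) (w n) = ?cart (g n)" for n using u_w by blast
    show "?bra (?cart (g n)) (w l) = fscale (\<omega> l (g n)) (w l)" for n l by (rule cart_w)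
    show \<omega>: "(\<Sum>l\<leftarrow>ls. \<omega> l (g n)) \<noteq> 0" if "n \<in> A'" "ls \<noteq> []" "set ls \<subseteq> A'" for n ls
      using that by (intro \<omega>_sum) (auto simp: A'_def)
    show "?cart (g n) \<noteq> 0" if "n \<in> A'" for n
    proof
      assume "?cart (g n) = 0"
      then have "\<omega> n (g n) = 0" by (rule \<omega>_zero)
      then show False using \<omega>[of n "[n]"] that by simp
    qed
  qed
  define Deg where "Deg r = nf ` degree_part r" for r
  have Deg_bra: "?bra f g \<in> Deg (r + s)" if fg: "f \<in> Deg r" "g \<in> Deg s" for f g r s
  proof -
    obtain f' g' where "f' \<in> degree_part r" "g' \<in> degree_part s" "f = nf f'" "g = nf g'"
      using fg unfolding Deg_def by blast
    then show ?thesis using br_degree_part[of f' r g' s] by (auto simp: Deg_def)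
  qed
  have w_Deg: "w n \<in> Deg (6 * int n + 1)" for n
  proof (rule w_degree_q[where Deg = Deg, OF Deg_bra])
    show "f + g \<in> Deg r" if fg: "f \<in> Deg r" "g \<in> Deg r" for f g r
    proof -
      obtain f' g' where "f' \<in> degree_part r" "g' \<in> degree_part r" "f = nf f'" "g = nf g'"
        using fg unfolding Deg_def by blast
      then show ?thesis
        unfolding Deg_def by (intro image_eqI[of _ _ "f' + g'"]) (auto simp: nf_add free.subspace_add[OF subspace_degree_part])
    qed
    show "fscale z f \<in> Deg r" if f: "f \<in> Deg r" for f z r
    proof -
      obtain f' where "f' \<in> degree_part r" "f = nf f'" using f unfolding Deg_def by blast
      then show ?thesis
        unfolding Deg_def by (intro image_eqI[of _ _ "fscale z f'"]) (auto simp: nf_scale free.subspace_scale[OF subspace_degree_part])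
    qed
    show "?x l \<in> Deg 1" for l by (simp add: Deg_def)
  qed
  have "\<exists>B. finite B \<and> card B \<le> poly P (nat \<bar>r\<bar>) \<and> degree_part r \<subseteq> free.span (I \<union> B)" for r
    by (rule quotient_dim_leD[OF P[of r, unfolded contragredient_dim_def, folded I_def]]) (intro exI conjI)
  then obtain B where B: "\<And>r. finite (B r)" "\<And>r. card (B r) \<le> poly P (nat \<bar>r\<bar>)"
    "\<And>r. degree_part r \<subseteq> free.span (I \<union> B r)"
    by metis
  \<comment> \<open>The degree bound \<open>N\<close> is linear in \<open>m\<close>, so
    \<open>(N + 1) * poly P N\<close> has degree at most \<open>degree P + 1\<close> in
    \<open>m\<close>; \<open>s\<close> exceeds this by one.\<close>
  define s where "s = degree P + 2"
  have s_pos: "s > 0" by (simp add: s_def)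
  \<comment> \<open>The position \<open>i\<close> of an index is recorded modulo \<open>s\<close>, so that distinct positions never share an index.\<close>
  define idx where "idx js = map (\<lambda>i. 2 * (s * (js ! i + 1) + i)) [0..<s]" for js
  \<comment> \<open>The linear expression is \<open>N\<close>, defined next: an index is at most
    \<open>2 * (s * m + s)\<close>, \<open>w n\<close> has degree \<open>6 * n + 1\<close>, and
    \<open>s\<close> such elements are bracketed.\<close>
  obtain m where m: "(12 * s * s * m + (12 * s + 1) * s + 1) * poly P (12 * s * s * m + (12 * s + 1) * s) < m ^ s"
    using exists_poly_linear_less_power[of "12 * s * s" "(12 * s + 1) * s" P] by (auto simp: s_def)
  define N where "N = 12 * s * s * m + (12 * s + 1) * s"
  define S where "S = {js. set js \<subseteq> {..<m} \<and> length js = s}"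
  have S: "finite S" "card S = m ^ s"
    by (simp_all add: S_def finite_lists_length_eq card_lists_length_eq)
  have idx_inj: "inj_on idx S"
  proof (rule inj_onI)
    fix js ls assume jl: "js \<in> S" "ls \<in> S" "idx js = idx ls"
    have "js ! i = ls ! i" if "i < s" for i
      using arg_cong[OF jl(3), of "\<lambda>xs. xs ! i"] that s_pos by (simp add: idx_def)
    then show "js = ls" using jl by (intro nth_equalityI) (auto simp: S_def)
  qed
  have nest_range: "\<exists>r. 0 \<le> r \<and> r \<le> int N \<and> dual.nest (idx js) \<in> Deg r" if js: "js \<in> S" for js
  proof -
    have "n \<le> 2 * (s * m + s)" if n: "n \<in> set (idx js)" for n
    proof -
      obtain i where i: "i < s" "n = 2 * (s * (js ! i + 1) + i)" using n by (auto simp: idx_def)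
      have "js ! i \<in> {..<m}" using js i(1) nth_mem[of i js] unfolding S_def by blast
      then have "js ! i + 1 \<le> m" by simp
      then show ?thesis using i by (simp only: i(2)) (intro mult_left_mono add_mono, auto)
    qed
    then have "(\<Sum>n\<leftarrow>idx js. 6 * n + 1) \<le> (\<Sum>n\<leftarrow>idx js. 6 * (2 * (s * m + s)) + 1)"
      by (intro sum_list_mono add_mono mult_left_mono) auto
    also have "\<dots> = N" by (simp add: sum_list_triv N_def idx_def algebra_simps)
    finally have le: "(\<Sum>n\<leftarrow>idx js. 6 * n + 1) \<le> N" .
    have eq: "(\<Sum>n\<leftarrow>ns. 6 * int n + 1) = int (\<Sum>n\<leftarrow>ns. 6 * n + 1)" for ns
      by (induction ns) auto
    have "dual.nest (idx js) \<in> Deg (\<Sum>n\<leftarrow>idx js. 6 * int n + 1)"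
      by (rule dual.nest_degree[where Deg = Deg, OF Deg_bra w_Deg]) (auto simp: idx_def s_def)
    then show ?thesis using le unfolding eq by (intro exI[of _ "int (\<Sum>n\<leftarrow>idx js. 6 * n + 1)"]) auto
  qed
  \<comment> \<open>The \<open>m ^ s\<close> nested brackets are independent, yet lie in the span of
    the vectors needed for degrees 0 to \<open>N\<close>.\<close>
  have "card S \<le> card (\<Union>r\<in>{0..int N}. nf ` B r)"
  proof (rule free.card_le_of_independent_family[where v = "\<lambda>js. dual.nest (idx js)"])
    show "finite (\<Union>r\<in>{0..int N}. nf ` B r)" using B(1) by simp
    show "(\<lambda>js. dual.nest (idx js)) ` S \<subseteq> free.span (\<Union>r\<in>{0..int N}. nf ` B r)"
    proof clarify
      fix js assume "js \<in> S"
      then obtain r f where r: "0 \<le> r" "r \<le> int N" "f \<in> degree_part r" "dual.nest (idx js) = nf f"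
        using nest_range unfolding Deg_def by blast
      have "nf f \<in> free.span (nf ` B r)" using B(3) r(3) by (intro nf_span_Un) blast
      also have "\<dots> \<subseteq> free.span (\<Union>r\<in>{0..int N}. nf ` B r)"
        using r(1,2) by (intro free.span_mono) auto
      finally show "dual.nest (idx js) \<in> free.span (\<Union>r\<in>{0..int N}. nf ` B r)" by (simp only: r(4))
    qed
    show "\<forall>js\<in>S. z js = 0" if z: "(\<Sum>js\<in>S. fscale (z js) (dual.nest (idx js))) = 0" for z
    proof
      fix js assume js: "js \<in> S"
      \<comment> \<open>Independence is available for families indexed by lists of string positions,
        so the coefficients are transported along the injection \<open>idx\<close>.\<close>
      define z' where "z' = z \<circ> the_inv_into S idx"
      have z': "z' (idx ls) = z ls" if "ls \<in> S" for ls
        using the_inv_into_f_f[OF idx_inj that] by (simp add: z'_def)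
      have "z' (idx js) = 0"
      proof (rule dual.nest_independent[where cls = "\<lambda>n. n div 2 mod s" and cs = "[0..<s]"])
        show "finite (idx ` S)" "distinct [0..<s]" "idx js \<in> idx ` S" using S js by auto
        show "as \<noteq> [] \<and> set as \<subseteq> A' \<and> map (\<lambda>n. n div 2 mod s) as = [0..<s]" if "as \<in> idx ` S" for as
        proof -
          obtain ls where ls: "as = idx ls" using \<open>as \<in> idx ` S\<close> by blast
          have "2 * (s * (ls ! i + 1) + i) div 2 mod s = i" if "i < s" for i
            using that by (simp only: nonzero_mult_div_cancel_left mod_mult_self4) simp
          then have "map (\<lambda>n. n div 2 mod s) as = [0..<s]"
            unfolding ls idx_def map_map by (intro map_idI) (simp only: comp_apply atLeastLessThan_iff set_upt)
          then show ?thesis using s_pos by (auto simp: ls idx_def A'_def)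
        qed
        show "(\<Sum>as\<in>idx ` S. fscale (z' as) (dual.nest as)) = 0"
          using z z' by (simp add: sum.reindex[OF idx_inj])
      qed
      then show "z js = 0" using z' js by simp
    qed
  qed (rule S)
  also have "\<dots> \<le> (\<Sum>r\<in>{0..int N}. card (nf ` B r))" by (rule card_UN_le) simp
  also have "\<dots> \<le> (\<Sum>r\<in>{0..int N}. poly P N)"
  proof (rule sum_mono)
    fix r assume r: "r \<in> {0..int N}"
    have "card (nf ` B r) \<le> card (B r)" by (rule card_image_le[OF B(1)])
    also have "\<dots> \<le> poly P (nat \<bar>r\<bar>)" by (rule B(2))
    also have "\<dots> \<le> poly P N" using r by (intro nat_poly_mono) auto
    finally show "card (nf ` B r) \<le> poly P N" .
  qed
  also have "\<dots> = (N + 1) * poly P N" by (simp add: nat_add_distrib)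
  also have "\<dots> < m ^ s" using m by (simp add: N_def)
  finally show False using S(2) by simp
qed

theorem lemma3p5:
  fixes m n t :: int and a b c :: real
    and sc :: "complex \<Rightarrow> 'h::ab_group_add \<Rightarrow> 'h"
    and hv :: "3 \<Rightarrow> 'h" and \<alpha> :: "3 \<Rightarrow> 'h \<Rightarrow> complex"
  assumes "m \<le> -1" "n \<le> -1" "t \<le> -1"
    and "\<not> (m = -1 \<and> n = -1 \<and> t = -1)"
    and "Q_minus m n t a b c \<or> Q_plus m n t a b c"
    and "realization sc (Q_matrix (complex_of_real a) (complex_of_real b) (complex_of_real c)) hv \<alpha>"
  shows "\<not> finite_growth sc hv \<alpha> Q_parity"
proof -
  \<comment> \<open>Both solution types give these inequalities, so a single argument covers
    them.\<close>
  have nz: "a \<noteq> 0" "b \<noteq> 0" "c \<noteq> 0" "1 + a \<noteq> 0" "1 + b \<noteq> 0"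
    and eqs: "1 + a + 1 / b = m" "1 + b + 1 / c = n" "1 + c + 1 / a = t"
    using assms(5) by (auto simp: Q_minus_def Q_plus_def Q_equations_def)
  have M: "1 + b + a * b = b * m" "1 + a + a * c = a * t" "1 + c + b * c = c * n"
    using nz by (simp_all add: eqs[symmetric] algebra_simps)
  \<comment> \<open>The quotient is the mean of \<open>1 / k\<close> and \<open>1 / l\<close>, which
    lie in the interval from -1 to 0 and are not both -1.\<close>
  have bounds: "-1 < (real_of_int k + real_of_int l) / (2 * real_of_int k * real_of_int l)" "(real_of_int k + real_of_int l) / (2 * real_of_int k * real_of_int l) < 0"
    if kl: "k \<le> -1" "l \<le> -1" "\<not> (k = -1 \<and> l = -1)" for k l
  proof -
    \<comment> \<open>Expanding gives \<open>k + l \<ge> - k * l - 1\<close>, and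
      \<open>k * l > 1\<close> makes this larger than \<open>- 2 * k * l\<close>.\<close>
    have "(k + 1) * (l + 1) \<ge> 0" using kl by (simp add: mult_nonpos_nonpos)
    moreover have "k * l > 1"
    proof (cases "k = -1")
      case False
      then have "(- k) * (- l) \<ge> 2 * 1" using kl by (intro mult_mono) auto
      then show ?thesis by simp
    qed (use kl in auto)
    ultimately have "- (2 * k * l) < k + l" by (simp add: algebra_simps)
    then have "real_of_int (- (2 * k * l)) < real_of_int (k + l)" by (simp only: of_int_less_iff)
    then have "-1 * (2 * real_of_int k * real_of_int l) < real_of_int k + real_of_int l" by simp
    moreover have P: "2 * real_of_int k * l > 0" using kl by (simp add: mult_neg_neg)
    ultimately show "-1 < (real_of_int k + real_of_int l) / (2 * real_of_int k * real_of_int l)"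
      by (simp only: pos_less_divide_eq)
    have "real_of_int k + l < 0" using kl by linarith
    from this P show "(real_of_int k + real_of_int l) / (2 * real_of_int k * real_of_int l) < 0" by (rule divide_neg_pos)
  qed
  show ?thesis
  proof (cases "m = -1 \<and> t = -1")
    case False
    \<comment> \<open>This is the weight \<open>q\<close> for \<open>M' = b * m\<close> and
      \<open>T' = a * t\<close>; the factor \<open>a * b\<close> cancels.\<close>
    have "(b * (a * t) + a * (b * m)) / (2 * (b * m) * (a * t)) = (real_of_int m + t) / (2 * m * t)"
      using nz assms(1,3) by (simp add: divide_simps) (simp add: algebra_simps)
    then show ?thesis
      using bounds[of m t] assms(1,3) nz False
      by (intro not_finite_growth[OF assms(6), of 1 2 3 Q_parity a b c "b * m" "a * t"])
        (simp_all add: Q_parity_def Q_matrix_def M)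
  next
    case True
    \<comment> \<open>Rotate the simple roots, which replaces \<open>(a, b, c)\<close> by \<open>(b, c, a)\<close> and \<open>(m, t)\<close> by \<open>(n, m)\<close>.\<close>
    then have "n \<noteq> -1" using assms(4) by blast
    have "(c * (b * m) + b * (c * n)) / (2 * (c * n) * (b * m)) = (real_of_int n + m) / (2 * n * m)"
      using nz assms(1,2) by (simp add: divide_simps) (simp add: algebra_simps)
    then show ?thesis
      using bounds[of n m] assms(1,2) nz \<open>n \<noteq> -1\<close> M
      by (intro not_finite_growth[OF assms(6), of 2 3 1 Q_parity b c a "c * n" "b * m"])
        (simp_all add: Q_parity_def Q_matrix_def algebra_simps)
  qed
qed

end
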